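(* Let $p \geq 7$ be a prime. Then $$\mathcal{W}_p \equiv \sum_{\nu=1}^{5} \omega_\nu \, p^{\nu-1} \pmod{p^5}$$ and equivalently $$(p-1)! \equiv \sum_{\nu=0}^{5} \omega_\nu \, p^\nu \pmod{p^6},$$ where $\omega_0 = -1$ and $\omega_1,\ldots,\omega_5 \in \mathbb{Z}_p$ are given by $$\omega_1 \equiv -5 \overline{\mathcal{B}}_1 + 10 \overline{\mathcal{B}}_2 - 10 \overline{\mathcal{B}}_3 + 5 \overline{\mathcal{B}}_4 - \overline{\mathcal{B}}_5 \pmod{p^5},$$ $$\omega_2 \equiv -\tfrac{5}{2} \overline{\mathcal{B}}_1^2 + \tfrac{15}{2} \overline{\mathcal{B}}_2^2 + \tfrac{5}{2} \overline{\mathcal{B}}_3^2 + \overline{\mathcal{B}}_1 \overline{\mathcal{B}}_4 - 9 \overline{\mathcal{B}}_2 \overline{\mathcal{B}}_3 \pmod{p^4},$$ $$\omega_3 \equiv -\tfrac{1}{2} \overline{\mathcal{B}}_1 \overline{\mathcal{B}}_2^2 - \overline{\mathcal{B}}_1^2 \left(\tfrac{5}{3} \overline{\mathcal{B}}_1 - \tfrac{5}{2} \overline{\mathcal{B}}_2 + \tfrac{1}{2} \overline{\mathcal{B}}_3\right) - \overline{\mathcal{B}}_{1,2} + \overline{\mathcal{B}}_{2,2} - \tfrac{1}{3} \overline{\mathcal{B}}_{3,2} \pmod{p^3},$$ $$\omega_4 \equiv -\tfrac{5}{24} \overline{\mathcal{B}}_1^4 + \tfrac{1}{6} \overline{\mathcal{B}}_1^3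 \overline{\mathcal{B}}_2 - \tfrac{2}{3} \overline{\mathcal{B}}_1 \overline{\mathcal{B}}_{1,2} + \tfrac{1}{3} \overline{\mathcal{B}}_2 \overline{\mathcal{B}}_{2,2} \pmod{p^2},$$ $$\omega_5 \equiv -\tfrac{1}{120} \overline{\mathcal{B}}_1^5 - \tfrac{1}{6} \overline{\mathcal{B}}_1^2 \overline{\mathcal{B}}_{1,2} - \tfrac{1}{5} \overline{\mathcal{B}}_{1,4} \pmod{p}.$$
   Context: For a prime $p$, the Wilson quotient is $\mathcal{W}_p = \frac{(p-1)!+1}{p}$, an integer by Wilson's theorem. The Bernoulli numbers $B_n \in \mathbb{Q}$ are defined by $\frac{t}{e^t-1} = \sum_{n \geq 0} B_n \frac{t^n}{n!}$. For a prime $p \geq 7$ and integers $n \geq 1$, define the divided Bernoulli numbers $$\overline{\mathcal{B}}_n = \frac{B_{n(p-1)} + \frac{1}{p} - 1}{n(p-1)}, \qquad \overline{\mathcal{B}}_{n,d} = \frac{B_{n(p-1)-d}}{n(p-1)-d} \quad (d \in \{2,4\}).$$ For the indices occurring in the claim these are $p$-integral rational numbers, i.e. elements of $\mathbb{Q} \cap \mathbb{Z}_p$, where $\mathbb{Z}_p$ is the ring of $p$-adic integers. Subscripts $\overline{\mathcal{B}}_{n,d}$ have first index $n$ and second index $d$. A congruence $a \equiv b \pmod{p^k}$ between elements of $\mathbb{Z}_p$ means $a - b \in p^k \mathbb{Z}_p$. *)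

theory Defs
  imports
    "HOL-Computational_Algebra.Formal_Power_Series"
    "HOL-Number_Theory.Modular_Inverse"
    "HOL-Algebra.Ideal"
begin

definition bernoulli_number :: "nat \<Rightarrow> rat" where
  "bernoulli_number n = fact n * fps_nth (fps_X / (fps_exp 1 - 1)) n"

lemma bernoulli_number_egf:
  "Abs_fps (\<lambda>n. bernoulli_number n / fact n) * (fps_exp 1 - 1) = fps_X"
proof -
  have nz: "fps_exp (1::rat) - 1 \<noteq> 0"
  proof
    assume "fps_exp (1::rat) - 1 = 0"
    hence "fps_nth (fps_exp (1::rat) - 1) 1 = 0" by simp
    thus False by simp
  qed
  have "subdegree (fps_exp (1::rat) - 1) \<le> 1"
    by (rule subdegree_leI) simp
  hence "fps_exp (1::rat) - 1 dvd fps_X"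
    using nz by (simp add: fps_dvd_iff)
  moreover have "Abs_fps (\<lambda>n. bernoulli_number n / fact n) = fps_X / (fps_exp 1 - 1)"
    by (rule fps_ext) (simp add: bernoulli_number_def)
  ultimately show ?thesis by simp
qed

definition wilson_quotient :: "nat \<Rightarrow> rat" where
  "wilson_quotient p = (fact (p - 1) + 1) / of_nat p"

definition divided_bernoulli :: "nat \<Rightarrow> nat \<Rightarrow> rat" where
  "divided_bernoulli p n =
     (bernoulli_number (n * (p - 1)) + 1 / of_nat p - 1) / of_nat (n * (p - 1))"

definition divided_bernoulli_shift :: "nat \<Rightarrow> nat \<Rightarrow> nat \<Rightarrow> rat" where
  "divided_bernoulli_shift p n d =
     bernoulli_number (n * (p - 1) - d) / of_nat (n * (p - 1) - d)"

text \<open>The ring of $p$-adic integers as the inverse limit of the rings $Z/p^k Z$: an element is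
  the sequence of its least nonnegative residues modulo $p^k$.\<close>

definition padic_int :: "nat \<Rightarrow> (nat \<Rightarrow> int) ring" where
  "padic_int p =
     \<lparr>carrier = {x. \<forall>k. 0 \<le> x k \<and> x k < int p ^ k \<and> x (Suc k) mod int p ^ k = x k},
      mult = (\<lambda>x y k. (x k * y k) mod int p ^ k),
      one = (\<lambda>k. 1 mod int p ^ k),
      zero = (\<lambda>k. 0),
      add = (\<lambda>x y k. (x k + y k) mod int p ^ k)\<rparr>"

text \<open>For a prime $p$ this is membership in the intersection of the rationals with the
  $p$-adic integers; \<open>quotient_of\<close> gives the reduced fraction.\<close>

definition p_integral :: "nat \<Rightarrow> rat \<Rightarrow> bool" where
  "p_integral p q \<longleftrightarrow> \<not> int p dvd snd (quotient_of q)"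

text \<open>The embedding of the $p$-integral rationals into the $p$-adic integers. Its value has no
  meaning on rationals that are not $p$-integral.\<close>

definition padic_of_rat :: "nat \<Rightarrow> rat \<Rightarrow> nat \<Rightarrow> int" where
  "padic_of_rat p q =
     (\<lambda>k. (fst (quotient_of q) * modular_inverse (int p ^ k) (snd (quotient_of q))) mod int p ^ k)"

definition padic_cong :: "nat \<Rightarrow> nat \<Rightarrow> (nat \<Rightarrow> int) \<Rightarrow> (nat \<Rightarrow> int) \<Rightarrow> bool" where
  "padic_cong p k a b \<longleftrightarrow>
     a \<ominus>\<^bsub>padic_int p\<^esub> b \<in> PIdl\<^bsub>padic_int p\<^esub> (padic_of_rat p (of_nat p ^ k))"

text \<open>The remaining facts confirm that the encoding is a commutative ring to which the
  $p$-integral rationals map homomorphically.\<close>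

lemma padic_int_cring:
  assumes p: "p > 0"
  shows "cring (padic_int p)"
proof -
  have P: "int p ^ k > 0" for k using p by simp
  have red: "z mod int p ^ Suc k mod int p ^ k = z mod int p ^ k" for z k
    by (rule mod_mod_cancel) simp
  have coh: "(f (x (Suc k)) (y (Suc k))) mod int p ^ Suc k mod int p ^ k = f (x k) (y k) mod int p ^ k"
    if "x (Suc k) mod int p ^ k = x k" "y (Suc k) mod int p ^ k = y k"
      "\<And>a b m. f (a mod m) (b mod m) mod m = f a b mod m"
    for f :: "int \<Rightarrow> int \<Rightarrow> int" and x y :: "nat \<Rightarrow> int" and k
    using that(3)[of "x (Suc k)" "int p ^ k" "y (Suc k)"] that(1,2) red by simp
  have cm: "(\<lambda>k. (x k * y k) mod int p ^ k) \<in> carrier (padic_int p)"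
    if "x \<in> carrier (padic_int p)" "y \<in> carrier (padic_int p)" for x y
    using that P coh[of x _ y "(*)"] by (auto simp: padic_int_def mod_mult_eq)
  have ca: "(\<lambda>k. (x k + y k) mod int p ^ k) \<in> carrier (padic_int p)"
    if "x \<in> carrier (padic_int p)" "y \<in> carrier (padic_int p)" for x y
    using that P coh[of x _ y "(+)"] by (auto simp: padic_int_def mod_add_eq)
  have cn: "(\<lambda>k. (- x k) mod int p ^ k) \<in> carrier (padic_int p)"
    if "x \<in> carrier (padic_int p)" for x
    using that P coh[of x _ x "\<lambda>a b. - a"] by (auto simp: padic_int_def mod_minus_eq)
  have c1: "(\<lambda>k. 1 mod int p ^ k) \<in> carrier (padic_int p)"
    using P red by (auto simp: padic_int_def)
  have id: "x k mod int p ^ k = x k" if "x \<in> carrier (padic_int p)" for x k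
    using that by (auto simp: padic_int_def)
  note ops = padic_int_def fun_eq_iff
  show ?thesis
  proof (rule cringI)
    show "abelian_group (padic_int p)"
    proof (rule abelian_groupI)
      fix x y assume "x \<in> carrier (padic_int p)" "y \<in> carrier (padic_int p)"
      then show "x \<oplus>\<^bsub>padic_int p\<^esub> y \<in> carrier (padic_int p)"
        using ca[of x y] by (simp add: padic_int_def)
    next
      show "\<zero>\<^bsub>padic_int p\<^esub> \<in> carrier (padic_int p)"
        using P by (simp add: padic_int_def)
    next
      fix x y z
      show "(x \<oplus>\<^bsub>padic_int p\<^esub> y) \<oplus>\<^bsub>padic_int p\<^esub> z = x \<oplus>\<^bsub>padic_int p\<^esub> (y \<oplus>\<^bsub>padic_int p\<^esub> z)"
        by (simp add: ops mod_simps ac_simps)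
      show "x \<oplus>\<^bsub>padic_int p\<^esub> y = y \<oplus>\<^bsub>padic_int p\<^esub> x"
        by (simp add: ops ac_simps)
    next
      fix x assume x: "x \<in> carrier (padic_int p)"
      show "\<zero>\<^bsub>padic_int p\<^esub> \<oplus>\<^bsub>padic_int p\<^esub> x = x"
        using id[OF x] by (simp add: ops)
      show "\<exists>y\<in>carrier (padic_int p). y \<oplus>\<^bsub>padic_int p\<^esub> x = \<zero>\<^bsub>padic_int p\<^esub>"
        by (rule bexI[OF _ cn[OF x]]) (simp add: ops mod_simps)
    qed
    show "comm_monoid (padic_int p)"
    proof (rule comm_monoidI)
      fix x y assume "x \<in> carrier (padic_int p)" "y \<in> carrier (padic_int p)"
      then show "x \<otimes>\<^bsub>padic_int p\<^esub> y \<in> carrier (padic_int p)"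
        using cm[of x y] by (simp add: padic_int_def)
    next
      show "\<one>\<^bsub>padic_int p\<^esub> \<in> carrier (padic_int p)"
        using c1 by (simp add: padic_int_def)
    next
      fix x y z
      show "(x \<otimes>\<^bsub>padic_int p\<^esub> y) \<otimes>\<^bsub>padic_int p\<^esub> z = x \<otimes>\<^bsub>padic_int p\<^esub> (y \<otimes>\<^bsub>padic_int p\<^esub> z)"
        by (simp add: ops mod_simps ac_simps)
      show "x \<otimes>\<^bsub>padic_int p\<^esub> y = y \<otimes>\<^bsub>padic_int p\<^esub> x"
        by (simp add: ops ac_simps)
    next
      fix x assume x: "x \<in> carrier (padic_int p)"
      show "\<one>\<^bsub>padic_int p\<^esub> \<otimes>\<^bsub>padic_int p\<^esub> x = x"
        using id[OF x] by (simp add: ops mod_simps)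
    qed
    fix x y z
    show "(x \<oplus>\<^bsub>padic_int p\<^esub> y) \<otimes>\<^bsub>padic_int p\<^esub> z
        = x \<otimes>\<^bsub>padic_int p\<^esub> z \<oplus>\<^bsub>padic_int p\<^esub> y \<otimes>\<^bsub>padic_int p\<^esub> z"
      by (simp add: ops mod_simps distrib_right)
  qed
qed

lemma p_integral_coprime:
  assumes "prime p" "p_integral p q"
  shows "coprime (snd (quotient_of q)) (int p ^ k)"
  using assms by (metis coprime_commute coprime_power_left_iff p_integral_def prime_imp_coprime prime_nat_int_transfer)

lemma padic_of_rat_eqI:
  assumes p: "prime p" and q: "p_integral p q"
    and q': "q * of_int b = of_int a" and b: "coprime b (int p)"
    and r: "[b * r = a] (mod int p ^ k)"
  shows "padic_of_rat p q k = r mod int p ^ k"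
proof -
  define n d where "n = fst (quotient_of q)" and "d = snd (quotient_of q)"
  have dpos: "d > 0" unfolding d_def by (rule quotient_of_denom_pos')
  have qe: "q = of_int n / of_int d"
    unfolding n_def d_def by (rule quotient_of_div) simp
  have "of_int (n * b) = (of_int (a * d) :: rat)"
    using q' dpos by (simp add: qe field_simps)
  hence nb: "n * b = a * d" using of_int_eq_iff by blast
  have cd: "coprime d (int p ^ k)" unfolding d_def by (rule p_integral_coprime[OF p q])
  define i where "i = modular_inverse (int p ^ k) d"
  have i: "[d * i = 1] (mod int p ^ k)"
    unfolding i_def using cd by (intro cong_modular_inverse1) (auto simp: coprime_commute)
  have "[b * (n * i) = a * (d * i)] (mod int p ^ k)"
    using nb by (metis cong_refl mult.assoc mult.commute)
  also have "[a * (d * i) = a * 1] (mod int p ^ k)" using i by (rule cong_scalar_left)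
  also have "[a * 1 = b * r] (mod int p ^ k)" using r by (simp add: cong_sym)
  finally have "[n * i = r] (mod int p ^ k)"
    using b by (simp add: cong_mult_lcancel coprime_commute)
  thus ?thesis by (simp add: padic_of_rat_def cong_def n_def d_def i_def)
qed

lemma padic_of_rat_cong:
  assumes p: "prime p" and q: "p_integral p q"
  shows "[snd (quotient_of q) * padic_of_rat p q k = fst (quotient_of q)] (mod int p ^ k)"
proof -
  have "[snd (quotient_of q) * modular_inverse (int p ^ k) (snd (quotient_of q)) = 1] (mod int p ^ k)"
    using p_integral_coprime[OF p q, of k] by (intro cong_modular_inverse1) (auto simp: coprime_commute)
  hence "[fst (quotient_of q) * (snd (quotient_of q) * modular_inverse (int p ^ k) (snd (quotient_of q)))
     = fst (quotient_of q) * 1] (mod int p ^ k)" by (rule cong_scalar_left)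
  thus ?thesis by (simp add: padic_of_rat_def cong_def mod_simps ac_simps)
qed

lemma rat_times_denom: "q * of_int (snd (quotient_of q)) = of_int (fst (quotient_of q))"
  using quotient_of_div[of q "fst (quotient_of q)" "snd (quotient_of q)"]
    quotient_of_denom_pos'[of q] by (simp add: field_simps)

lemma p_integral_iff:
  assumes p: "prime p"
  shows "p_integral p q \<longleftrightarrow> (\<exists>a b. q * of_int b = of_int a \<and> \<not> int p dvd b)"
proof
  assume "p_integral p q"
  thus "\<exists>a b. q * of_int b = of_int a \<and> \<not> int p dvd b"
    using rat_times_denom[of q] unfolding p_integral_def by blast
next
  assume "\<exists>a b. q * of_int b = of_int a \<and> \<not> int p dvd b"
  then obtain a b where ab: "q * of_int b = of_int a" "\<not> int p dvd b" by blast
  define n d where "n = fst (quotient_of q)" and "d = snd (quotient_of q)"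
  have dpos: "d > 0" unfolding d_def by (rule quotient_of_denom_pos')
  have qe: "q * of_int d = of_int n" unfolding n_def d_def by (rule rat_times_denom)
  have cop: "coprime n d" unfolding n_def d_def by (rule quotient_of_coprime) simp
  have "(of_int (n * b) :: rat) = q * of_int d * of_int b" by (simp add: qe)
  also have "\<dots> = of_int (a * d)" using ab(1) by (simp add: mult_ac)
  finally have "n * b = a * d" using of_int_eq_iff by blast
  hence "d dvd b" using cop by (metis coprime_commute coprime_dvd_mult_right_iff dvd_triv_right)
  thus "p_integral p q" using ab(2) unfolding p_integral_def d_def[symmetric] by (meson dvd_trans)
qed

lemma p_integral_add:
  assumes p: "prime p" and "p_integral p q" "p_integral p r"
  shows "p_integral p (q + r)"
proof -
  obtain a b c d where "q * of_int b = of_int a" "\<not> int p dvd b"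
    "r * of_int d = of_int c" "\<not> int p dvd d"
    using assms by (auto simp: p_integral_iff[OF p])
  moreover from this have "(q + r) * of_int (b * d) = of_int (a * d + c * b)"
    by (simp add: algebra_simps flip: \<open>q * of_int b = of_int a\<close> \<open>r * of_int d = of_int c\<close>)
  ultimately show ?thesis
    using p p_integral_iff[OF p] by (metis prime_dvd_mult_iff prime_nat_int_transfer)
qed

lemma p_integral_mult:
  assumes p: "prime p" and "p_integral p q" "p_integral p r"
  shows "p_integral p (q * r)"
proof -
  obtain a b c d where "q * of_int b = of_int a" "\<not> int p dvd b"
    "r * of_int d = of_int c" "\<not> int p dvd d"
    using assms by (auto simp: p_integral_iff[OF p])
  moreover from this have "(q * r) * of_int (b * d) = of_int (a * c)"
    by (simp add: algebra_simps flip: \<open>q * of_int b = of_int a\<close> \<open>r * of_int d = of_int c\<close>)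
  ultimately show ?thesis
    using p p_integral_iff[OF p] by (metis prime_dvd_mult_iff prime_nat_int_transfer)
qed

lemma padic_of_rat_closed:
  assumes p: "prime p" and q: "p_integral p q"
  shows "padic_of_rat p q \<in> carrier (padic_int p)"
proof -
  have P: "int p ^ k > 0" for k using p by (simp add: prime_gt_0_nat)
  have "padic_of_rat p q (Suc k) mod int p ^ k = padic_of_rat p q k" for k
  proof -
    have "[snd (quotient_of q) * padic_of_rat p q (Suc k) = fst (quotient_of q)] (mod int p ^ k)"
      by (rule cong_dvd_modulus[OF padic_of_rat_cong[OF p q]]) simp
    thus ?thesis
      using padic_of_rat_eqI[OF p q rat_times_denom] p_integral_coprime[OF p q, of 1] by simp
  qed
  thus ?thesis using P by (auto simp: padic_int_def padic_of_rat_def)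
qed

lemma padic_of_rat_of_int: "padic_of_rat p (of_int a) k = a mod int p ^ k"
proof -
  have "[1 * modular_inverse (int p ^ k) 1 = 1] (mod int p ^ k)"
    by (intro cong_modular_inverse1) auto
  hence "[a * modular_inverse (int p ^ k) 1 = a * 1] (mod int p ^ k)"
    by (intro cong_scalar_left) simp
  thus ?thesis by (simp add: padic_of_rat_def cong_def)
qed

lemma padic_of_rat_one: "padic_of_rat p 1 = \<one>\<^bsub>padic_int p\<^esub>"
  using padic_of_rat_of_int[of p 1] by (simp add: padic_int_def fun_eq_iff)

lemma padic_of_rat_add:
  assumes p: "prime p" and q: "p_integral p q" and r: "p_integral p r"
  shows "padic_of_rat p (q + r) = padic_of_rat p q \<oplus>\<^bsub>padic_int p\<^esub> padic_of_rat p r"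
proof
  fix k
  define a b c d where "a = fst (quotient_of q)" and "b = snd (quotient_of q)"
    and "c = fst (quotient_of r)" and "d = snd (quotient_of r)"
  have "[b * padic_of_rat p q k * d + d * padic_of_rat p r k * b = a * d + c * b] (mod int p ^ k)"
    unfolding a_def b_def c_def d_def
    by (intro cong_add cong_scalar_right padic_of_rat_cong p q r)
  hence "[b * d * (padic_of_rat p q k + padic_of_rat p r k) = a * d + c * b] (mod int p ^ k)"
    by (simp add: algebra_simps)
  moreover have "(q + r) * of_int (b * d) = of_int (a * d + c * b)"
    by (simp add: a_def b_def c_def d_def algebra_simps flip: rat_times_denom)
  moreover have "coprime (b * d) (int p)"
    using p_integral_coprime[OF p q, of 1] p_integral_coprime[OF p r, of 1] by (simp add: b_def d_def)
  ultimately have "padic_of_rat p (q + r) k = (padic_of_rat p q k + padic_of_rat p r k) mod int p ^ k"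
    using padic_of_rat_eqI[OF p p_integral_add[OF p q r]] by blast
  thus "padic_of_rat p (q + r) k = (padic_of_rat p q \<oplus>\<^bsub>padic_int p\<^esub> padic_of_rat p r) k"
    by (simp add: padic_int_def)
qed

lemma padic_of_rat_mult:
  assumes p: "prime p" and q: "p_integral p q" and r: "p_integral p r"
  shows "padic_of_rat p (q * r) = padic_of_rat p q \<otimes>\<^bsub>padic_int p\<^esub> padic_of_rat p r"
proof
  fix k
  define a b c d where "a = fst (quotient_of q)" and "b = snd (quotient_of q)"
    and "c = fst (quotient_of r)" and "d = snd (quotient_of r)"
  have "[(b * padic_of_rat p q k) * (d * padic_of_rat p r k) = a * c] (mod int p ^ k)"
    unfolding a_def b_def c_def d_def
    by (intro cong_mult padic_of_rat_cong p q r)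
  hence "[b * d * (padic_of_rat p q k * padic_of_rat p r k) = a * c] (mod int p ^ k)"
    by (simp add: algebra_simps)
  moreover have "(q * r) * of_int (b * d) = of_int (a * c)"
    by (simp add: a_def b_def c_def d_def algebra_simps flip: rat_times_denom)
  moreover have "coprime (b * d) (int p)"
    using p_integral_coprime[OF p q, of 1] p_integral_coprime[OF p r, of 1] by (simp add: b_def d_def)
  ultimately have "padic_of_rat p (q * r) k = (padic_of_rat p q k * padic_of_rat p r k) mod int p ^ k"
    using padic_of_rat_eqI[OF p p_integral_mult[OF p q r]] by blast
  thus "padic_of_rat p (q * r) k = (padic_of_rat p q \<otimes>\<^bsub>padic_int p\<^esub> padic_of_rat p r) k"
    by (simp add: padic_int_def)
qed

end

theory Submission
  imports Defs "HOL-Number_Theory.Residues"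
begin

text \<open>
  Write \<open>B\<^sub>n\<close> and \<open>B\<^bsub>n,d\<^esub>\<close> for the divided Bernoulli numbers. The idea is to take the \<open>p\<close>-adic logarithm of
  \<open>-(p-1)!\<close>, which is congruent to \<open>1\<close> modulo \<open>p\<close>. Since \<open>p - 1\<close> is even,
  \<open>(-(p-1)!)\<^bsup>p-1\<^esup>\<close> is the product of the \<open>a\<^bsup>p-1\<^esup> = 1 + p q\<^sub>a\<close> over \<open>0 < a < p\<close>, hence

  \<open>(p - 1) log(-(p-1)!) = \<Sum>\<^sub>a log(a\<^bsup>p-1\<^esup>)\<close>.

  Modulo \<open>p\<^sup>6\<close> the logarithm may be replaced by its Taylor polynomial of degree five, which makes the
  right-hand side a combination of the power sums \<open>\<Sum>\<^sub>a a\<^bsup>n(p-1)\<^esup>\<close> with \<open>1 \<le> n \<le> 5\<close>. By Bernoulli's formula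
  these are polynomials in \<open>p\<close> with Bernoulli numbers as coefficients, and only the Bernoulli numbers with indices
  \<open>n(p-1)\<close>, \<open>n(p-1) - 2\<close> and \<open>n(p-1) - 4\<close> matter. The coefficients of the logarithm are such that the
  combination extrapolates a sequence from \<open>n = 1, ..., 5\<close> to \<open>n = 0\<close>. The result (\<open>log_neg_fact\<close>) is

  \<open>log(-(p-1)!) \<equiv> p \<beta> + p\<^sup>3 \<delta> / 3 + p\<^sup>5 B\<^bsub>1,4\<^esub> / 5  (mod p\<^sup>6)\<close>,

  where \<open>\<beta>\<close> and \<open>\<delta>\<close> are the values of \<open>B\<^sub>n\<close> and \<open>B\<^bsub>n,2\<^esub>\<close> extrapolated to \<open>n = 0\<close>. Applying the exponential
  gives the expansion of \<open>(p-1)!\<close> (\<open>neg_fact_expansion\<close>), whose coefficients are, up to sign, \<open>\<beta>\<close>, \<open>\<beta>\<^sup>2/2\<close>,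
  \<open>\<beta>\<^sup>3/6 + \<delta>/3\<close>, \<open>\<beta>\<^sup>4/24 + \<beta>\<delta>/3\<close> and \<open>\<beta>\<^sup>5/120 + \<beta>\<^sup>2\<delta>/6 + B\<^bsub>1,4\<^esub>/5\<close>.

  The coefficients \<open>\<omega>\<^sub>\<nu>\<close> of the theorem are these numbers, written with fewer divided Bernoulli numbers as less
  precision is needed (\<open>coefficient_congruences\<close>). This rests on Kummer's congruences: the \<open>k\<close>th
  differences of \<open>B\<^sub>n\<close> at \<open>n = 1\<close> for \<open>k \<le> 4\<close>, and of \<open>B\<^bsub>n,2\<^esub>\<close> for \<open>k \<le> 3\<close>, are divisible by \<open>p\<^sup>k\<close>. For
  \<open>B\<^bsub>n,2\<^esub>\<close> they come from expressing Genocchi numbers by alternating power sums (\<open>genocchi_congruence\<close>), in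
  which \<open>n\<close> only appears as the exponent of \<open>a\<^bsup>p-1\<^esup> \<equiv> 1\<close>. For \<open>B\<^sub>n\<close> they come from the binomial expansion of
  \<open>(1 + p q\<^sub>a)\<^sup>n\<close> in the same power sums as above (\<open>divided_bernoulli_kummer\<close>).

  The congruences are proved for rational numbers that are integral at \<open>p\<close>. They carry over to \<open>Z\<^sub>p\<close>
  because two of its elements are congruent modulo \<open>p\<^sup>k\<close> exactly when their residues modulo \<open>p\<^sup>k\<close> agree
  (\<open>padic_cong_iff\<close>).
\<close>

section \<open>Congruences between rational numbers that are integral at a prime\<close>

locale fixed_prime =
  fixes p :: nat
  assumes p: "prime p"
begin

abbreviation pint :: "rat \<Rightarrow> bool" where "pint \<equiv> p_integral p"

abbreviation \<pi> :: rat where "\<pi> \<equiv> of_nat p"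

definition pcong :: "nat \<Rightarrow> rat \<Rightarrow> rat \<Rightarrow> bool" where
  "pcong k a b \<longleftrightarrow> pint ((a - b) / \<pi> ^ k)"

lemma p_nz [simp]: "p \<noteq> 0"
  using p by auto

lemma prime_int_p: "prime (int p)"
  using p by simp

lemma pint_of_int [simp]: "pint (of_int a)"
  unfolding p_integral_iff[OF p] using prime_int_p
  by (intro exI[of _ a] exI[of _ 1]) (auto simp: prime_int_iff zdvd1_eq)

lemma pint_of_nat [simp]: "pint (of_nat a)"
  using pint_of_int[of "int a"] by simp

lemma pint_numeral [simp]: "pint (numeral a)"
  using pint_of_int[of "numeral a"] by simp

lemma pint_0 [simp]: "pint 0" and pint_1 [simp]: "pint 1"
  using pint_of_int[of 0] pint_of_int[of 1] by simp_all

lemma pint_add [simp]: "pint a \<Longrightarrow> pint b \<Longrightarrow> pint (a + b)"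
  by (rule p_integral_add[OF p])

lemma pint_mult [simp]: "pint a \<Longrightarrow> pint b \<Longrightarrow> pint (a * b)"
  by (rule p_integral_mult[OF p])

lemma pint_minus [simp]: "pint a \<Longrightarrow> pint (- a)"
  using pint_mult[OF pint_of_int[of "-1"], of a] by simp

lemma pint_diff [simp]: "pint a \<Longrightarrow> pint b \<Longrightarrow> pint (a - b)"
  using pint_add[OF _ pint_minus, of a b] by simp

lemma pint_power [simp]: "pint a \<Longrightarrow> pint (a ^ n)"
  by (induction n) auto

lemma pint_sum [intro]: "(\<And>i. i \<in> A \<Longrightarrow> pint (f i)) \<Longrightarrow> pint (sum f A)"
  by (induction A rule: infinite_finite_induct) auto

lemma pint_inverse_of_int: "\<not> int p dvd b \<Longrightarrow> pint (1 / of_int b)"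
  unfolding p_integral_iff[OF p]
  by (intro exI[of _ 1] exI[of _ b]) auto

lemma pint_divide: "pint a \<Longrightarrow> \<not> int p dvd b \<Longrightarrow> pint (a / of_int b)"
  using pint_mult[OF _ pint_inverse_of_int, of a b] by simp

lemma pint_cancel_of_int: "pint (of_int b * a) \<Longrightarrow> \<not> int p dvd b \<Longrightarrow> pint a"
  using pint_divide[of "of_int b * a" b] by (cases "b = 0") auto

lemma pint_div_numeral:
  "pint a \<Longrightarrow> \<not> p dvd numeral b \<Longrightarrow> pint (a / numeral b)"
  using pint_divide[of a "numeral b"] by (metis of_int_numeral int_dvd_int_iff of_nat_numeral)

lemma pint_of_int_div:
  assumes "pint (of_int a / \<pi> ^ k)" shows "int p ^ k dvd a"
proof -
  obtain c d where cd: "of_int a / \<pi> ^ k * of_int d = of_int c" "\<not> int p dvd d"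
    using assms unfolding p_integral_iff[OF p] by blast
  hence "of_int (a * d) = (of_int (c * int p ^ k) :: rat)" by (simp add: field_simps)
  hence "a * d = c * int p ^ k" using of_int_eq_iff by blast
  hence "int p ^ k dvd a * d" by simp
  moreover have "coprime (int p ^ k) d"
    using cd(2) prime_int_p by (simp add: prime_imp_coprime)
  ultimately show ?thesis by (simp add: coprime_dvd_mult_left_iff)
qed

text \<open>A denominator smaller than \<open>p ^ (j + 1)\<close> is divisible by at most the \<open>j\<close>th power of \<open>p\<close>.\<close>

lemma pint_power_div_small:
  assumes "0 < c" "c < p ^ Suc j"
  shows "pint (\<pi> ^ j / of_nat c)"
proof -
  have "p > 1" using p prime_gt_1_nat by blast
  obtain d where d: "c = p ^ multiplicity p c * d" "\<not> p dvd d"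
    using multiplicity_decompose'[of c p] assms(1) \<open>p > 1\<close> by auto
  have "d > 0" using d(2) by (cases d) simp_all
  define v where "v = multiplicity p c"
  have "p ^ v * 1 \<le> p ^ v * d"
    using \<open>d > 0\<close> by (intro mult_left_mono) linarith+
  hence "p ^ v < p ^ Suc j" using assms(2) d(1) unfolding v_def by linarith
  hence "v \<le> j" using \<open>p > 1\<close> power_less_imp_less_exp less_Suc_eq_le by blast
  hence "\<pi> ^ j = \<pi> ^ v * \<pi> ^ (j - v)" by (simp flip: power_add)
  hence "\<pi> ^ j / of_nat c = \<pi> ^ (j - v) / of_int (int d)"
    by (subst d(1)) (simp add: v_def[symmetric])
  thus ?thesis using d(2) by (simp only:) (intro pint_divide; simp)
qed

lemma pcong_refl [simp]: "pcong k a a"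
  by (simp add: pcong_def)

lemma pcong_sym: "pcong k a b \<Longrightarrow> pcong k b a"
  unfolding pcong_def using pint_minus[of "(a - b) / \<pi> ^ k"] by (simp add: minus_divide_left)

lemma pcong_trans [trans]: "pcong k a b \<Longrightarrow> pcong k b c \<Longrightarrow> pcong k a c"
  unfolding pcong_def using pint_add[of "(a - b) / \<pi> ^ k" "(b - c) / \<pi> ^ k"]
  by (simp flip: add_divide_distrib)

lemma pcong_add: "pcong k a b \<Longrightarrow> pcong k c d \<Longrightarrow> pcong k (a + c) (b + d)"
  unfolding pcong_def using pint_add[of "(a - b) / \<pi> ^ k" "(c - d) / \<pi> ^ k"]
  by (simp add: algebra_simps flip: add_divide_distrib)

lemma pcong_minus: "pcong k a b \<Longrightarrow> pcong k (- a) (- b)"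
  unfolding pcong_def using pint_minus[of "(a - b) / \<pi> ^ k"]
  by (simp add: minus_divide_left)

lemma pcong_diff: "pcong k a b \<Longrightarrow> pcong k c d \<Longrightarrow> pcong k (a - c) (b - d)"
  using pcong_add[OF _ pcong_minus, of k a b c d] by simp

lemma pcong_lmult: "pint c \<Longrightarrow> pcong k a b \<Longrightarrow> pcong k (c * a) (c * b)"
  unfolding pcong_def using pint_mult[of c "(a - b) / \<pi> ^ k"]
  by (simp add: algebra_simps)

lemma pcong_pint: "pcong k a b \<Longrightarrow> pint b \<Longrightarrow> pint a"
  unfolding pcong_def using pint_add[OF pint_mult[of "\<pi> ^ k" "(a - b) / \<pi> ^ k"], of b]
  by (simp del: pint_add pint_mult)

lemma pcong_mult:
  "pcong k a b \<Longrightarrow> pcong k c d \<Longrightarrow> pint b \<Longrightarrow> pint d \<Longrightarrow> pcong k (a * c) (b * d)"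
  using pcong_trans[of k "a * c" "a * d" "b * d"] pcong_lmult[of a k c d]
    pcong_lmult[of d k a b] pcong_pint[of k a b]
  by (simp add: mult.commute)

lemma pcong_power: "pcong k a b \<Longrightarrow> pint b \<Longrightarrow> pcong k (a ^ n) (b ^ n)"
  by (induction n) (auto intro: pcong_mult)

lemma pcong_sum: "(\<And>i. i \<in> A \<Longrightarrow> pcong k (f i) (g i)) \<Longrightarrow> pcong k (sum f A) (sum g A)"
  by (induction A rule: infinite_finite_induct) (auto intro: pcong_add)

lemma pcong_weaken: "pcong k a b \<Longrightarrow> j \<le> k \<Longrightarrow> pcong j a b"
  unfolding pcong_def
  using pint_mult[OF pint_power[OF pint_of_nat[of p], of "k - j"], of "(a - b) / \<pi> ^ k"]
  by (simp add: power_diff del: pint_mult pint_power)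

lemma pcong_scale: "pcong k a b \<longleftrightarrow> pcong (j + k) (\<pi> ^ j * a) (\<pi> ^ j * b)"
  unfolding pcong_def by (simp add: power_add flip: right_diff_distrib)

lemma pcongI: "a - b = \<pi> ^ k * c \<Longrightarrow> pint c \<Longrightarrow> pcong k a b"
  unfolding pcong_def by simp

lemma pcongE:
  assumes "pcong k a b" obtains c where "pint c" "a = b + \<pi> ^ k * c"
  using assms that[of "(a - b) / \<pi> ^ k"] unfolding pcong_def by simp

lemma pcong_of_int: "pcong k (of_int a) (of_int b) \<longleftrightarrow> [a = b] (mod int p ^ k)"
proof
  assume "pcong k (of_int a) (of_int b)"
  thus "[a = b] (mod int p ^ k)"
    unfolding pcong_def cong_iff_dvd_diff using pint_of_int_div[of "a - b" k] by (simp only: of_int_diff)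
next
  assume "[a = b] (mod int p ^ k)"
  then obtain c where "a - b = int p ^ k * c" by (auto simp: cong_iff_dvd_diff)
  hence "of_int a - of_int b = \<pi> ^ k * (of_int c :: rat)"
    by (metis of_int_diff of_int_mult of_int_of_nat_eq of_int_power)
  thus "pcong k (of_int a) (of_int b)" by (rule pcongI) simp
qed

lemma pcong_cancel_of_int:
  assumes "pcong k (of_int c * a) (of_int c * b)" "\<not> int p dvd c"
  shows "pcong k a b"
  using assms unfolding pcong_def
  by (metis pint_cancel_of_int right_diff_distrib times_divide_eq_right)

end

section \<open>Bernoulli numbers, power sums and alternating power sums\<close>

abbreviation bernoulli_egf :: "rat fps" where
  "bernoulli_egf \<equiv> Abs_fps (\<lambda>n. bernoulli_number n / fact n)"

lemma fps_exp_minus_one_nz: "c \<noteq> 0 \<Longrightarrow> fps_exp (c :: rat) - 1 \<noteq> 0"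
proof
  assume "c \<noteq> 0" "fps_exp c - 1 = 0"
  hence "fps_nth (fps_exp c - 1) 1 = 0" by simp
  with \<open>c \<noteq> 0\<close> show False by simp
qed

text \<open>This is \<open>F(t) (e\<^sup>t - 1) = t\<close> with \<open>c t\<close> in place of \<open>t\<close>. It is used with \<open>c = -1\<close>, for the
  numbers of odd index, and with \<open>c = 2\<close>, for the Genocchi numbers.\<close>

lemma bernoulli_egf_scaled:
  "Abs_fps (\<lambda>n. c ^ n * (bernoulli_number n / fact n)) * (fps_exp c - 1) = fps_const c * fps_X"
proof -
  have "(bernoulli_egf * (fps_exp 1 - 1)) oo (fps_const c * fps_X) = fps_const c * fps_X"
    by (simp add: bernoulli_number_egf)
  thus ?thesis
    by (simp add: fps_compose_mult_distrib fps_compose_sub_distrib)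
       (simp add: fps_compose_linear)
qed

lemma bernoulli_number_0 [simp]: "bernoulli_number 0 = 1"
  using arg_cong[OF bernoulli_number_egf, of "\<lambda>f. fps_nth f 1"] by (simp add: fps_mult_nth)

text \<open>The generating function \<open>F\<close> satisfies \<open>F(-t) = F(t) + t\<close>, so only \<open>B\<^sub>1\<close> survives
  among the coefficients of odd index.\<close>

lemma bernoulli_egf_reflect:
  "Abs_fps (\<lambda>n. (-1) ^ n * (bernoulli_number n / fact n)) = bernoulli_egf + fps_X"
proof -
  define F where "F = bernoulli_egf"
  define G where "G = Abs_fps (\<lambda>n. (-1) ^ n * (bernoulli_number n / fact n))"
  have e: "fps_exp (- 1) * fps_exp (1 :: rat) = 1"
    by (simp flip: fps_exp_add_mult)
  have F: "F * (fps_exp 1 - 1) = fps_X" unfolding F_def by (rule bernoulli_number_egf)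
  have "G * (fps_exp (- 1) - 1) * fps_exp 1 = - fps_X * fps_exp 1"
    unfolding G_def by (subst bernoulli_egf_scaled) (simp flip: fps_const_neg)
  moreover have "G * (fps_exp (- 1) - 1) * fps_exp 1 = G * (fps_exp (- 1) * fps_exp 1) - G * fps_exp 1"
    by (simp add: algebra_simps)
  ultimately have "G * (fps_exp 1 - 1) = fps_X * fps_exp 1"
    unfolding e by (simp add: right_diff_distrib) (simp add: algebra_simps)
  also have "\<dots> = F * (fps_exp 1 - 1) * fps_exp 1" by (simp add: F)
  also have "\<dots> = (F * (fps_exp 1 - 1) + F) * (fps_exp 1 - 1)"
    by (simp add: algebra_simps)
  also have "F * (fps_exp 1 - 1) = fps_X" by (rule F)
  finally show ?thesis
    using fps_exp_minus_one_nz[of 1] unfolding F_def G_def by (simp add: add.commute)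
qed

lemma bernoulli_number_odd: "odd n \<Longrightarrow> n \<noteq> 1 \<Longrightarrow> bernoulli_number n = 0"
  using arg_cong[OF bernoulli_egf_reflect, of "\<lambda>f. fps_nth f n"] by simp

lemma bernoulli_number_1: "bernoulli_number 1 = - 1 / 2"
  using arg_cong[OF bernoulli_egf_reflect, of "\<lambda>f. fps_nth f 1"] by simp

lemma fact_times_choose:
  "k \<le> m \<Longrightarrow> fact m * (x / fact k * (y / fact (m - k))) = of_nat (m choose k) * x * (y :: rat)"
  by (simp add: binomial_fact)

text \<open>Summing the geometric progression gives
  \<open>(1 + e\<^sup>t + ... + e\<^bsup>(N-1)t\<^esup>) t = (e\<^bsup>Nt\<^esup> - 1) F(t)\<close>; the coefficients of \<open>t\<^bsup>m+1\<^esup>\<close> are compared.\<close>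

lemma sum_powers_bernoulli:
  "(\<Sum>a<N. of_nat a ^ m) =
   (\<Sum>k\<le>m. of_nat (m choose k) * of_nat N ^ Suc k / of_nat (Suc k) * bernoulli_number (m - k))"
proof -
  have "(\<Sum>a<N. fps_exp (of_nat a)) * (fps_exp 1 - 1) = fps_exp (of_nat N :: rat) - 1"
    by (induction N) (simp_all add: algebra_simps fps_exp_add_mult)
  hence "(\<Sum>a<N. fps_exp (of_nat a)) * (fps_exp 1 - 1) * bernoulli_egf
      = (fps_exp (of_nat N) - 1) * bernoulli_egf"
    by (rule arg_cong)
  hence *: "(\<Sum>a<N. fps_exp (of_nat a)) * fps_X = (fps_exp (of_nat N) - 1) * bernoulli_egf"
    by (simp only: mult.assoc mult.commute[of "fps_exp 1 - 1"] bernoulli_number_egf)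
  have "(\<Sum>a<N. of_nat a ^ m) / fact m
      = (\<Sum>k=0..Suc m. fps_nth (fps_exp (of_nat N) - 1) k * (bernoulli_number (Suc m - k) / fact (Suc m - k)))"
    using arg_cong[OF *, of "\<lambda>f. fps_nth f (Suc m)"]
    by (simp add: fps_mult_nth[of _ bernoulli_egf] fps_sum_nth sum_divide_distrib)
  also have "\<dots> = (\<Sum>k\<le>m. of_nat N ^ Suc k / fact (Suc k) * (bernoulli_number (m - k) / fact (m - k)))"
    by (simp add: atLeast0AtMost sum.atMost_Suc_shift del: sum.atMost_Suc)
  finally have "fact m * ((\<Sum>a<N. of_nat a ^ m) / fact m)
      = (\<Sum>k\<le>m. fact m * (of_nat N ^ Suc k / fact (Suc k) * (bernoulli_number (m - k) / fact (m - k))))"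
    by (simp only: sum_distrib_left)
  also have "\<dots> = (\<Sum>k\<le>m. of_nat (m choose k) * of_nat N ^ Suc k / of_nat (Suc k) * bernoulli_number (m - k))"
    by (intro sum.cong refl) (simp add: binomial_fact mult_ac)
  finally show ?thesis by simp
qed

text \<open>The series \<open>F(t) - F(2t)\<close> is \<open>t / (e\<^sup>t + 1)\<close>, the generating function of the Genocchi
  numbers.\<close>

lemma genocchi_egf:
  "Abs_fps (\<lambda>n. (1 - 2 ^ n) * (bernoulli_number n / fact n)) * (1 + fps_exp 1) = fps_X"
proof -
  define F where "F = bernoulli_egf"
  define F2 where "F2 = Abs_fps (\<lambda>n. 2 ^ n * (bernoulli_number n / fact n))"
  have G: "Abs_fps (\<lambda>n. (1 - 2 ^ n) * (bernoulli_number n / fact n)) = F - F2"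
    unfolding F_def F2_def by (rule fps_ext) (simp add: algebra_simps)
  have F: "F * (fps_exp 1 - 1) = fps_X" unfolding F_def by (rule bernoulli_number_egf)
  have e2: "fps_exp 2 = fps_exp 1 * fps_exp (1 :: rat)"
    by (simp flip: fps_exp_add_mult)
  have F2: "F2 * (fps_exp 2 - 1) = fps_const 2 * fps_X"
    unfolding F2_def by (rule bernoulli_egf_scaled)
  have "(F - F2) * (1 + fps_exp 1) * (fps_exp 1 - 1)
      = F * (fps_exp 1 - 1) * (1 + fps_exp 1) - F2 * (fps_exp 2 - 1)"
    unfolding e2 by (simp add: algebra_simps)
  also have "\<dots> = fps_X * (1 + fps_exp 1) - fps_X * 2"
    unfolding F F2 by (simp add: numeral_fps_const mult.commute)
  also have "\<dots> = fps_X * (fps_exp 1 - 1)" by (simp add: algebra_simps)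
  finally show ?thesis unfolding G using fps_exp_minus_one_nz[of 1] by simp
qed

text \<open>For odd \<open>N\<close> the alternating progression sums to \<open>(1 + e\<^bsup>Nt\<^esup>) / (1 + e\<^sup>t)\<close>, whose denominator is that
  of the Genocchi series. The coefficients of \<open>t\<^sup>m\<close> are compared; the term \<open>1\<close> and the constant term
  of \<open>e\<^bsup>Nt\<^esup>\<close> both contribute \<open>(1 - 2\<^sup>m) B\<^sub>m\<close>, hence the factor \<open>2\<close>. Unlike the plain power sum, where \<open>B\<^sub>m\<close> is
  multiplied by \<open>N\<close>, this identity loses no power of \<open>p\<close> when \<open>N\<close> is a power of \<open>p\<close>.\<close>

lemma alternating_sum_powers_bernoulli:
  assumes "odd N" "m \<ge> 1"
  shows "of_nat m * (\<Sum>a<N. (-1) ^ a * of_nat a ^ (m - 1)) =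
    2 * (1 - 2 ^ m) * bernoulli_number m +
    (\<Sum>k\<in>{1..m}. of_nat (m choose k) * of_nat N ^ k * ((1 - 2 ^ (m - k)) * bernoulli_number (m - k)))"
proof -
  define G where "G = Abs_fps (\<lambda>n. (1 - 2 ^ n) * (bernoulli_number n / fact n))"
  define A where "A = (\<Sum>a<N. fps_const ((-1) ^ a) * fps_exp (of_nat a :: rat))"
  have "(\<Sum>a<N. fps_const ((-1) ^ a) * fps_exp (of_nat a)) * (1 + fps_exp 1)
      = 1 - fps_const ((-1) ^ N) * fps_exp (of_nat N :: rat)"
    by (induction N) (simp_all add: algebra_simps fps_exp_add_mult flip: fps_const_neg)
  hence "A * (1 + fps_exp 1) = 1 + fps_exp (of_nat N)"
    using \<open>odd N\<close> by (simp add: A_def flip: fps_const_neg)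
  hence "A * (1 + fps_exp 1) * G = (1 + fps_exp (of_nat N)) * G"
    by (rule arg_cong)
  hence *: "A * fps_X = (1 + fps_exp (of_nat N)) * G"
    by (simp only: mult.assoc mult.commute[of "1 + fps_exp 1"] genocchi_egf G_def)
  obtain l where l: "m = Suc l" using assms(2) by (cases m) auto
  have "(\<Sum>a<N. (-1) ^ a * of_nat a ^ l) / fact l
      = (\<Sum>k=0..m. fps_nth (1 + fps_exp (of_nat N)) k * fps_nth G (m - k))"
    using arg_cong[OF *, of "\<lambda>f. fps_nth f m"]
    by (simp add: l A_def fps_mult_nth[of _ G] fps_sum_nth sum_divide_distrib)
  also have "\<dots> = 2 * ((1 - 2 ^ m) * (bernoulli_number m / fact m)) +
     (\<Sum>k\<in>{1..m}. of_nat N ^ k / fact k * ((1 - 2 ^ (m - k)) * bernoulli_number (m - k) / fact (m - k)))"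
    by (subst sum.atLeast_Suc_atMost) (auto simp: G_def intro!: sum.cong)
  finally have "fact m * ((\<Sum>a<N. (-1) ^ a * of_nat a ^ l) / fact l)
      = fact m * (2 * ((1 - 2 ^ m) * (bernoulli_number m / fact m))) + (\<Sum>k\<in>{1..m}. fact m *
      (of_nat N ^ k / fact k * ((1 - 2 ^ (m - k)) * bernoulli_number (m - k) / fact (m - k))))"
    by (simp only: distrib_left sum_distrib_left)
  also have "\<dots> = 2 * (1 - 2 ^ m) * bernoulli_number m +
    (\<Sum>k\<in>{1..m}. of_nat (m choose k) * of_nat N ^ k * ((1 - 2 ^ (m - k)) * bernoulli_number (m - k)))"
    by (intro arg_cong2[of _ _ _ _ "(+)"] sum.cong refl fact_times_choose) auto
  also have "fact m * ((\<Sum>a<N. (-1) ^ a * of_nat a ^ l) / fact l)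
      = of_nat m * (\<Sum>a<N. (-1) ^ a * of_nat a ^ (m - 1) :: rat)"
    by (simp add: l)
  finally show ?thesis .
qed

section \<open>Kummer congruences modulo the cube of a prime\<close>

context fixed_prime
begin

lemma pint_half: "odd p \<Longrightarrow> pint a \<Longrightarrow> pint (a / 2)"
  using p by (intro pint_div_numeral) (auto dest!: dvd_imp_le simp: prime_nat_iff le_Suc_eq numeral_2_eq_2)

text \<open>A part of the von Staudt-Clausen theorem. In the formula for the sum of the \<open>a\<^sup>n\<close> over
  \<open>0 \<le> a < p\<close>, \<open>p B\<^sub>n\<close> is the leading term, and the others are products of \<open>p B\<^bsub>n-k\<^esub>\<close> with the integral
  numbers \<open>p\<^sup>k / (k + 1)\<close>.\<close>

lemma pint_p_bernoulli: "pint (\<pi> * bernoulli_number n)"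
proof (induction n rule: less_induct)
  case (less n)
  define T where "T = (\<lambda>k. of_nat (n choose k) * \<pi> ^ Suc k / of_nat (Suc k) * bernoulli_number (n - k))"
  have "(\<Sum>a<p. of_nat a ^ n) = (\<Sum>k\<le>n. T k)"
    unfolding T_def by (rule sum_powers_bernoulli)
  also have "\<dots> = T 0 + (\<Sum>k\<in>{1..n}. T k)"
    by (simp add: atMost_atLeast0 sum.atLeast_Suc_atMost)
  finally have eq: "\<pi> * bernoulli_number n = (\<Sum>a<p. of_nat a ^ n) - (\<Sum>k\<in>{1..n}. T k)"
    by (simp add: T_def)
  have T: "pint (T k)" if "k \<in> {1..n}" for k
  proof -
    have "Suc k < p ^ Suc k"
      using power_gt_expt[of p "Suc k"] prime_gt_1_nat[OF p] by simp
    hence 1: "pint (\<pi> ^ k / of_nat (Suc k))"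
      by (intro pint_power_div_small) auto
    have 2: "pint (\<pi> * bernoulli_number (n - k))"
      using that by (intro less) auto
    show ?thesis
      using pint_mult[OF pint_of_nat[of "n choose k"] pint_mult[OF 1 2]]
      by (simp add: T_def mult_ac)
  qed
  show ?case
    unfolding eq by (intro pint_diff pint_sum T pint_power pint_of_nat)
qed

text \<open>Voronoi's congruence for the base \<open>2\<close>: a divided Bernoulli number is, up to the factor
  \<open>2 (1 - 2\<^sup>m)\<close>, an integral combination of \<open>(m - 1)\<close>st powers. The length \<open>N = p\<^sup>4\<close> of the sum suffices for
  the modulus \<open>p\<^sup>3\<close>: after division by \<open>m\<close> the error terms contain \<open>N\<^sup>k / k\<close>, and a single factor
  \<open>p\<close> is needed to make \<open>B\<^bsub>m-k\<^esub>\<close> integral.\<close>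

lemma genocchi_congruence:
  assumes "odd p" "m \<ge> 1"
  shows "pcong 3 (2 * (1 - 2 ^ m) * (bernoulli_number m / of_nat m))
     (\<Sum>a<p ^ 4. (-1) ^ a * of_nat a ^ (m - 1))"
proof -
  define T where "T = (\<lambda>k. of_nat ((m - 1) choose (k - 1)) *
     ((1 - 2 ^ (m - k)) * ((\<pi> ^ (4 * k - 4) / of_nat k) * (\<pi> * bernoulli_number (m - k)))))"
  have T: "of_nat (m choose k) * of_nat (p ^ 4) ^ k * ((1 - 2 ^ (m - k)) * bernoulli_number (m - k))
      = of_nat m * (\<pi> ^ 3 * T k)" if "k \<in> {1..m}" for k
  proof -
    have "of_nat k * of_nat (m choose k) = (of_nat m * of_nat ((m - 1) choose (k - 1)) :: rat)"
      using times_binomial_minus1_eq[of k m] that by (metis One_nat_def Suc_le_eq atLeastAtMost_iff of_nat_mult)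
    hence "of_nat (m choose k) = (of_nat m * of_nat ((m - 1) choose (k - 1)) / of_nat k :: rat)"
      using that by (simp add: field_simps)
    moreover have "of_nat (p ^ 4) ^ k = \<pi> ^ 3 * \<pi> ^ (4 * k - 4) * \<pi>"
      using that by (simp flip: power_mult power_add power_Suc2) 
    ultimately show ?thesis by (simp add: T_def)
  qed
  have "of_nat m * (\<Sum>a<p ^ 4. (-1) ^ a * of_nat a ^ (m - 1))
      = 2 * (1 - 2 ^ m) * bernoulli_number m + (\<Sum>k\<in>{1..m}. of_nat m * (\<pi> ^ 3 * T k))"
    using alternating_sum_powers_bernoulli[OF _ assms(2), of "p ^ 4"] assms(1)
    by (simp only: T even_power simp_thms cong: sum.cong)
  also have "\<dots> = of_nat m * (2 * (1 - 2 ^ m) * (bernoulli_number m / of_nat m) + \<pi> ^ 3 * (\<Sum>k\<in>{1..m}. T k))"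
    using assms(2) by (simp add: distrib_left sum_distrib_left)
  finally have eq: "2 * (1 - 2 ^ m) * (bernoulli_number m / of_nat m) - (\<Sum>a<p ^ 4. (-1) ^ a * of_nat a ^ (m - 1))
      = \<pi> ^ 3 * (- (\<Sum>k\<in>{1..m}. T k))"
    using assms(2) by simp
  have "pint (T k)" if "k \<in> {1..m}" for k
  proof -
    have "k < 2 ^ k" by (rule less_exp)
    also have "(2::nat) ^ k \<le> p ^ k" using p prime_ge_2_nat by (intro power_mono) auto
    also have "\<dots> \<le> p ^ Suc (4 * k - 4)"
      using that p prime_ge_1_nat by (intro power_increasing) auto
    finally have "pint (\<pi> ^ (4 * k - 4) / of_nat k)"
      using that by (intro pint_power_div_small) auto
    thus ?thesis unfolding T_def
      by (intro pint_mult pint_diff pint_power pint_p_bernoulli) auto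
  qed
  thus ?thesis by (intro pcongI[OF eq] pint_minus pint_sum)
qed

lemma pcong_cancel_unit:
  assumes "pcong k (c * a) (c * b)" "pint (1 / c)" "c \<noteq> 0"
  shows "pcong k a b"
  using pcong_lmult[OF assms(2,1)] assms(3) by simp

lemma fermat_power:
  assumes "\<not> p dvd a" shows "[a ^ (n * (p - 1)) = 1] (mod p)"
  using cong_pow[OF fermat_theorem[OF p assms], of n] by (simp add: power_mult[symmetric] mult.commute)

lemma fermat_power_minus:
  assumes "n \<ge> 1" "d < p - 1"
  shows "[a ^ (n * (p - 1) - d) = a ^ (p - 1 - d)] (mod p)"
proof (cases "p dvd a")
  case True
  have "n * (p - 1) \<ge> 1 * (p - 1)" using assms(1) by (intro mult_right_mono) auto
  hence "n * (p - 1) - d > 0" "p - 1 - d > 0" using assms(2) by linarith+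
  thus ?thesis using True
    by (metis cong_0_iff cong_sym cong_trans dvd_power_iff dvd_trans dvd_power)
next
  case False
  have "n * (p - 1) - d = (n - 1) * (p - 1) + (p - 1 - d)"
    using assms by (cases n) auto
  thus ?thesis
    using cong_scalar_right[OF fermat_power[OF False, of "n - 1"], of "a ^ (p - 1 - d)"]
    by (simp add: power_add)
qed

text \<open>The binomial expansion up to the quadratic term, ordered by powers of \<open>n\<close>.\<close>

lemma one_plus_power_pcong:
  assumes "pint q" "odd p"
  shows "pcong 3 ((1 + \<pi> * q) ^ n)
     (1 + of_nat n * (\<pi> * (q - \<pi> * q\<^sup>2 / 2)) + (of_nat n)\<^sup>2 * (\<pi>\<^sup>2 * (q\<^sup>2 / 2)))"
proof (induction n)
  case 0
  show ?case by simp
next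
  case (Suc n)
  define E where "E = (\<lambda>n. 1 + of_nat n * (\<pi> * (q - \<pi> * q\<^sup>2 / 2)) + (of_nat n)\<^sup>2 * (\<pi>\<^sup>2 * (q\<^sup>2 / 2)))"
  have "pcong 3 ((1 + \<pi> * q) * (1 + \<pi> * q) ^ n) ((1 + \<pi> * q) * E n)"
    using Suc assms(1) unfolding E_def by (intro pcong_lmult) auto
  also have "pcong 3 ((1 + \<pi> * q) * E n) (E (Suc n))"
  proof (rule pcongI)
    show "(1 + \<pi> * q) * E n - E (Suc n) = \<pi> ^ 3 * (((of_nat n)\<^sup>2 - of_nat n) * q ^ 3 / 2)"
      by (simp add: E_def power2_eq_square power3_eq_cube field_simps)
    show "pint (((of_nat n)\<^sup>2 - of_nat n) * q ^ 3 / 2)"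
      using assms by (intro pint_half) auto
  qed
  finally show ?case by (simp add: E_def)
qed

text \<open>The sequences that are, modulo \<open>p\<^sup>3\<close>, quadratic polynomials in \<open>n\<close> whose coefficient of \<open>n\<^sup>i\<close> is
  divisible by \<open>p\<^sup>i\<close>, for all \<open>n \<ge> 1\<close>. This is the form in which Kummer's
  congruences are used. It is inherited by linear combinations and by quotients, and the polynomial
  may be evaluated at \<open>n = 0\<close>, where the sequence itself need not have this value.\<close>

definition kummer_quadratic :: "(nat \<Rightarrow> rat) \<Rightarrow> rat \<Rightarrow> rat \<Rightarrow> rat \<Rightarrow> bool" where
  "kummer_quadratic f x u v \<longleftrightarrow> pint x \<and> pint u \<and> pint v \<and>
     (\<forall>n\<ge>1. pcong 3 (f n) (x + of_nat n * (\<pi> * u) + (of_nat n)\<^sup>2 * (\<pi>\<^sup>2 * v)))"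

lemma kummer_quadratic_cmult:
  assumes "kummer_quadratic f x u v" "pint c"
  shows "kummer_quadratic (\<lambda>n. c * f n) (c * x) (c * u) (c * v)"
proof -
  have "pcong 3 (c * f n) (c * x + of_nat n * (\<pi> * (c * u)) + (of_nat n)\<^sup>2 * (\<pi>\<^sup>2 * (c * v)))"
    if "n \<ge> 1" for n
    using pcong_lmult[OF assms(2), of 3 "f n"] assms(1) that
    by (fastforce simp: kummer_quadratic_def algebra_simps)
  thus ?thesis using assms by (simp add: kummer_quadratic_def)
qed

lemma kummer_quadratic_sum:
  assumes "\<And>i. i \<in> I \<Longrightarrow> kummer_quadratic (f i) (x i) (u i) (v i)"
  shows "kummer_quadratic (\<lambda>n. \<Sum>i\<in>I. f i n) (sum x I) (sum u I) (sum v I)"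
proof -
  have "pcong 3 (\<Sum>i\<in>I. f i n) (\<Sum>i\<in>I. x i + of_nat n * (\<pi> * u i) + (of_nat n)\<^sup>2 * (\<pi>\<^sup>2 * v i))"
    if "n \<ge> 1" for n
    using assms that by (intro pcong_sum) (auto simp: kummer_quadratic_def)
  thus ?thesis using assms
    unfolding kummer_quadratic_def
    by (auto simp: sum.distrib sum_distrib_left intro!: pint_sum)
qed

lemma kummer_quadratic_pcong:
  assumes "kummer_quadratic f x u v" "\<And>n. n \<ge> 1 \<Longrightarrow> pcong 3 (g n) (f n)"
  shows "kummer_quadratic g x u v"
  using assms unfolding kummer_quadratic_def by (blast intro: pcong_trans)

lemma kummer_quadratic_power:
  assumes "\<not> p dvd a" "odd p"
  shows "\<exists>u v. kummer_quadratic (\<lambda>n. of_nat a ^ (n * (p - 1))) 1 u v"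
proof -
  obtain k where k: "int (a ^ (p - 1)) - 1 = int p * k"
    using fermat_theorem[OF p assms(1)] by (metis cong_iff_dvd_diff cong_int_iff dvdE of_nat_1)
  define q :: rat where "q = of_int k"
  have q: "pint q" by (simp add: q_def)
  have "of_int (int (a ^ (p - 1)) - 1) = (of_int (int p * k) :: rat)" by (simp only: k)
  hence a: "of_nat a ^ (p - 1) = 1 + \<pi> * q" by (simp add: q_def algebra_simps)
  have "pint (q\<^sup>2 / 2)" 
    using q assms(2) by (intro pint_half) auto
  moreover from this have "pint (q - \<pi> * (q\<^sup>2 / 2))" using q by (intro pint_diff pint_mult) auto
  moreover have "of_nat a ^ (n * (p - 1)) = (1 + \<pi> * q) ^ n" for n
    by (metis a power_mult mult.commute)
  ultimately show ?thesis
    using one_plus_power_pcong[OF q assms(2)] unfolding kummer_quadratic_def by fastforce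
qed

text \<open>For \<open>a\<close> prime to \<open>p\<close> the sequence is \<open>a\<^bsup>-d\<^esup> (a\<^bsup>p-1\<^esup>)\<^sup>n\<close>, with \<open>a\<^bsup>p-1\<^esup> \<equiv> 1\<close>. For \<open>a\<close> divisible by \<open>p\<close> it
  vanishes modulo \<open>p\<^sup>3\<close>, because the exponents are at least \<open>3\<close>.\<close>

lemma kummer_quadratic_power_minus:
  assumes "odd p" "d + 3 \<le> p - 1"
  shows "\<exists>x u v. kummer_quadratic (\<lambda>n. of_nat a ^ (n * (p - 1) - d)) x u v"
proof (cases "p dvd a")
  case True
  then obtain b where b: "a = p * b" by auto
  have "pcong 3 (of_nat a ^ (n * (p - 1) - d)) 0" if "n \<ge> 1" for n
  proof -
    have "n * (p - 1) \<ge> 1 * (p - 1)" using that by (intro mult_right_mono) auto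
    hence "n * (p - 1) - d = 3 + (n * (p - 1) - d - 3)" using assms(2) by linarith
    hence "of_nat a ^ (n * (p - 1) - d) - 0 =
        \<pi> ^ 3 * (\<pi> ^ (n * (p - 1) - d - 3) * of_nat b ^ (n * (p - 1) - d))"
      unfolding b by (metis diff_zero mult.assoc of_nat_mult power_add power_mult_distrib)
    thus ?thesis by (rule pcongI) auto
  qed
  thus ?thesis unfolding kummer_quadratic_def
    by (intro exI[of _ 0]) auto
next
  case False
  obtain u v where uv: "kummer_quadratic (\<lambda>n. of_nat a ^ (n * (p - 1))) 1 u v"
    using kummer_quadratic_power[OF False assms(1)] by blast
  have "\<not> p dvd a ^ d" using False p prime_dvd_power by blast
  hence "\<not> int p dvd int (a ^ d)" by (simp only: int_dvd_int_iff not_False_eq_True)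
  from pint_inverse_of_int[OF this] have "pint (1 / of_nat a ^ d)" by simp
  note kq = kummer_quadratic_cmult[OF uv this]
  have "of_nat a ^ (n * (p - 1) - d) = 1 / of_nat a ^ d * (of_nat a ^ (n * (p - 1)) :: rat)"
    if "n \<ge> 1" for n
  proof -
    have "n * (p - 1) \<ge> 1 * (p - 1)" using that by (intro mult_right_mono) auto
    moreover have "a \<noteq> 0" using False by (metis dvd_0_right)
    moreover from calculation have "d \<le> n * (p - 1)" using assms(2) by linarith
    ultimately show ?thesis by (simp add: power_diff)
  qed
  thus ?thesis using kummer_quadratic_pcong[OF kq, of "\<lambda>n. of_nat a ^ (n * (p - 1) - d)"] by fastforce
qed

text \<open>The three coefficients of the quotient are found by comparing coefficients, as in the division of
  power series in \<open>p n\<close>; only the constant coefficient of the divisor must be a unit.\<close>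

lemma kummer_quadratic_quotient:
  assumes fh: "kummer_quadratic (\<lambda>n. h n * f n) X U V" and h: "kummer_quadratic h y w z"
    and y: "y \<noteq> 0" "pint (1 / y)" and hn: "\<And>n. n \<ge> 1 \<Longrightarrow> h n \<noteq> 0 \<and> pint (1 / h n)"
  shows "\<exists>x u v. kummer_quadratic f x u v"
proof -
  define x where "x = 1 / y * X"
  define u where "u = 1 / y * (U - x * w)"
  define v where "v = 1 / y * (V - x * z - u * w)"
  have pints: "pint X" "pint U" "pint V" "pint w" "pint z" "pint y"
    using fh h by (auto simp: kummer_quadratic_def)
  have x: "pint x" unfolding x_def by (rule pint_mult[OF y(2) pints(1)])
  have u: "pint u" unfolding u_def
    by (intro pint_mult y pint_diff x pints)
  have v: "pint v" unfolding v_def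
    by (intro pint_mult y pint_diff x u pints)
  have XUV: "X = y * x" "U = y * u + x * w" "V = y * v + x * z + u * w"
    using y(1) by (simp_all add: x_def u_def v_def)
  have "pcong 3 (f n) (x + of_nat n * (\<pi> * u) + (of_nat n)\<^sup>2 * (\<pi>\<^sup>2 * v))" (is "pcong 3 _ ?q")
    if n: "n \<ge> 1" for n
  proof (rule pcong_cancel_unit[of _ "h n"])
    have "pcong 3 (h n * f n) (X + of_nat n * (\<pi> * U) + (of_nat n)\<^sup>2 * (\<pi>\<^sup>2 * V))"
      using fh n by (auto simp: kummer_quadratic_def)
    also have "pcong 3 \<dots> ((y + of_nat n * (\<pi> * w) + (of_nat n)\<^sup>2 * (\<pi>\<^sup>2 * z)) * ?q)"
    proof (rule pcong_sym, rule pcongI)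
      show "(y + of_nat n * (\<pi> * w) + (of_nat n)\<^sup>2 * (\<pi>\<^sup>2 * z)) * ?q
           - (X + of_nat n * (\<pi> * U) + (of_nat n)\<^sup>2 * (\<pi>\<^sup>2 * V))
         = \<pi> ^ 3 * (of_nat n ^ 3 * (w * v + z * u) + \<pi> * (of_nat n ^ 4 * (z * v)))"
        unfolding XUV by (simp add: algebra_simps eval_nat_numeral)
    qed (auto intro!: pint_add pint_mult simp: pints x u v)
    also have "pcong 3 \<dots> (h n * ?q)"
    proof (rule pcong_mult)
      show "pcong 3 (y + of_nat n * (\<pi> * w) + (of_nat n)\<^sup>2 * (\<pi>\<^sup>2 * z)) (h n)"
        using h n by (auto simp: kummer_quadratic_def intro: pcong_sym)
      have "pcong 3 (h n) (y + of_nat n * (\<pi> * w) + (of_nat n)\<^sup>2 * (\<pi>\<^sup>2 * z))"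
        using h n by (auto simp: kummer_quadratic_def)
      thus "pint (h n)" by (rule pcong_pint) (auto simp: pints)
    qed (auto simp: x u v)
    finally show "pcong 3 (h n * f n) (h n * ?q)" .
  qed (use hn n in auto)
  thus ?thesis using x u v by (auto simp: kummer_quadratic_def)
qed

end

locale prime_at_least_7 = fixed_prime +
  assumes p7: "p \<ge> 7"
begin

abbreviation B :: "nat \<Rightarrow> rat" where "B \<equiv> divided_bernoulli p"
abbreviation Bd :: "nat \<Rightarrow> nat \<Rightarrow> rat" where "Bd \<equiv> divided_bernoulli_shift p"

lemma odd_p: "odd p"
  using prime_odd_nat[OF p] p7 by simp

lemma p_not_dvd: "0 < b \<Longrightarrow> b < 7 \<Longrightarrow> \<not> p dvd b"
  using p7 by (auto dest: dvd_imp_le)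

lemma pint_div_small: "pint a \<Longrightarrow> numeral b < (7::nat) \<Longrightarrow> pint (a / numeral b)"
  by (intro pint_div_numeral p_not_dvd) auto

lemma even_index: "even (n * (p - 1))"
  using odd_p by simp

lemma index_ge: "n \<ge> 1 \<Longrightarrow> n * (p - 1) \<ge> p - 1"
  using mult_right_mono[of 1 n "p - 1"] by simp

lemma index_ge_6: "n \<ge> 1 \<Longrightarrow> n * (p - 1) \<ge> 6"
  using index_ge[of n] p7 by linarith

lemma of_nat_index: "of_nat (n * (p - 1)) = of_nat n * (\<pi> - 1)"
  using p7 by (simp add: of_nat_diff)

text \<open>The factor \<open>2\<^sup>m - 1\<close> of the Genocchi numbers is a unit at \<open>p\<close>, because \<open>m = n (p - 1) - d\<close>
  gives \<open>2\<^sup>d (2\<^sup>m - 1) \<equiv> 1 - 2\<^sup>d\<close>, which is \<open>-3\<close> or \<open>-15\<close>.\<close>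

lemma genocchi_factor_unit:
  assumes "n \<ge> 1" "d \<in> {2, 4}"
  shows "pint (1 / (2 * (1 - 2 ^ (n * (p - 1) - d))))" "2 * (1 - 2 ^ (n * (p - 1) - d)) \<noteq> (0 :: rat)"
proof -
  define m where "m = n * (p - 1) - d"
  have md: "m + d = n * (p - 1)" using assms(2) index_ge_6[OF assms(1)] unfolding m_def by auto
  have nd: "\<not> int p dvd 2 * (1 - 2 ^ m)"
  proof
    assume "int p dvd 2 * (1 - 2 ^ m)"
    moreover have "\<not> int p dvd 2" using p_not_dvd[of 2] by (simp flip: int_dvd_int_iff)
    ultimately have "int p dvd 1 - 2 ^ m"
      using prime_dvd_mult_iff[OF prime_int_p, of 2 "1 - 2 ^ m"] by blast
    hence "int p dvd (1 - 2 ^ m) * 2 ^ d" by simp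
    also have "(1 - 2 ^ m) * 2 ^ d = 2 ^ d - (2 :: int) ^ (n * (p - 1))"
      unfolding md[symmetric] by (simp add: left_diff_distrib power_add)
    finally have 1: "int p dvd 2 ^ d - 2 ^ (n * (p - 1))" .
    have "[2 ^ (n * (p - 1)) = 1] (mod p)" using fermat_power[of 2 n] p_not_dvd[of 2] by simp
    hence "[int (2 ^ (n * (p - 1))) = int 1] (mod int p)" by (simp only: cong_int_iff)
    hence 2: "int p dvd 2 ^ (n * (p - 1)) - 1" by (simp add: cong_iff_dvd_diff)
    have "int p dvd 2 ^ d - 1" using dvd_add[OF 1 2] by simp
    hence "int p dvd int 3 \<or> int p dvd int 15" using assms(2) by auto
    hence "p dvd 3 \<or> p dvd 3 * 5" by (simp only: int_dvd_int_iff) simp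
    thus False using p_not_dvd[of 3] p_not_dvd[of 5] prime_dvd_mult_iff[OF p, of 3 5] by simp
  qed
  have c: "of_int (2 * (1 - 2 ^ m)) = (2 * (1 - 2 ^ m) :: rat)" by simp
  show "pint (1 / (2 * (1 - 2 ^ (n * (p - 1) - d))))"
    by (rule pint_inverse_of_int[OF nd, unfolded c, unfolded m_def])
  have "2 * (1 - 2 ^ m) \<noteq> (0 :: int)" using nd by (metis dvd_0_right)
  thus "2 * (1 - 2 ^ (n * (p - 1) - d)) \<noteq> (0 :: rat)"
    unfolding m_def[symmetric] c[symmetric] of_int_eq_0_iff .
qed

lemma divided_bernoulli_shift_genocchi:
  assumes "n \<ge> 1" "d \<in> {2, 4}"
  shows "pcong 3 (2 * (1 - 2 ^ (n * (p - 1) - d)) * Bd n d)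
     (\<Sum>a<p ^ 4. (-1) ^ a * of_nat a ^ (n * (p - 1) - (d + 1)))"
proof -
  have "n * (p - 1) - d \<ge> 1" using assms(2) index_ge_6[OF assms(1)] by auto
  from genocchi_congruence[OF odd_p this] show ?thesis
    by (simp add: divided_bernoulli_shift_def)
qed

lemma pint_Bd: "n \<ge> 1 \<Longrightarrow> d \<in> {2, 4} \<Longrightarrow> pint (Bd n d)"
proof -
  assume *: "n \<ge> 1" "d \<in> {2, 4}"
  define c :: rat where "c = 2 * (1 - 2 ^ (n * (p - 1) - d))"
  have "pint (c * Bd n d)"
    unfolding c_def using divided_bernoulli_shift_genocchi[OF *] by (rule pcong_pint) auto
  from pint_mult[OF genocchi_factor_unit(1)[OF *] this] show "pint (Bd n d)"
    using genocchi_factor_unit(2)[OF *] by (simp add: c_def)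
qed

text \<open>In \<open>h\<^sub>n B\<^bsub>n,2\<^esub> \<equiv> \<Sum>(-1)\<^sup>a a\<^bsup>n(p-1)-3\<^esup>\<close>, both the right-hand side and the Genocchi factors
  \<open>h\<^sub>n = 2 - 2\<^bsup>n(p-1)\<^esup> / 2\<close> are quadratic sequences, so the quotient is one as well. The smallest
  exponent \<open>p - 4\<close> is at least \<open>3\<close>, as the quadratic form of the powers requires, because \<open>p \<ge> 7\<close>.\<close>

lemma Bd2_kummer: "\<exists>x u v. kummer_quadratic (\<lambda>n. Bd n 2) x u v"
proof -
  define h :: "nat \<Rightarrow> rat" where "h = (\<lambda>n. 2 * (1 - 2 ^ (n * (p - 1) - 2)))"
  have "\<forall>a. \<exists>x u v. kummer_quadratic (\<lambda>n. of_nat a ^ (n * (p - 1) - 3)) x u v"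
    using kummer_quadratic_power_minus[OF odd_p, of 3] p7 by simp
  then obtain x u v where xuv: "kummer_quadratic (\<lambda>n. of_nat a ^ (n * (p - 1) - 3)) (x a) (u a) (v a)" for a
    by metis
  have "kummer_quadratic (\<lambda>n. \<Sum>a<p ^ 4. (-1) ^ a * of_nat a ^ (n * (p - 1) - 3))
     (\<Sum>a<p ^ 4. (-1) ^ a * x a) (\<Sum>a<p ^ 4. (-1) ^ a * u a) (\<Sum>a<p ^ 4. (-1) ^ a * v a)"
    by (intro kummer_quadratic_sum kummer_quadratic_cmult xuv) auto
  hence fh: "kummer_quadratic (\<lambda>n. h n * Bd n 2)
     (\<Sum>a<p ^ 4. (-1) ^ a * x a) (\<Sum>a<p ^ 4. (-1) ^ a * u a) (\<Sum>a<p ^ 4. (-1) ^ a * v a)"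
    by (rule kummer_quadratic_pcong) (use divided_bernoulli_shift_genocchi[of _ 2] in \<open>auto simp: h_def\<close>)
  obtain u' v' where "kummer_quadratic (\<lambda>n. of_nat 2 ^ (n * (p - 1))) 1 u' v'"
    using kummer_quadratic_power[OF _ odd_p, of 2] p_not_dvd[of 2] by auto
  from kummer_quadratic_cmult[OF this, of "- (1 / 2)"]
  have kq: "kummer_quadratic (\<lambda>n. - (1 / 2) * 2 ^ (n * (p - 1))) (- (1 / 2)) (- (1 / 2) * u') (- (1 / 2) * v')"
    using pint_div_small[of 1 "num.Bit0 num.One"] by simp
  have heq: "h n = 2 + - (1 / 2) * 2 ^ (n * (p - 1))" if "n \<ge> 1" for n
  proof -
    have "n * (p - 1) = 2 + (n * (p - 1) - 2)" using index_ge[OF that] p7 by linarith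
    hence "(2::rat) ^ (n * (p - 1)) = 2\<^sup>2 * 2 ^ (n * (p - 1) - 2)" by (metis power_add)
    thus ?thesis by (simp add: h_def)
  qed
  have h: "kummer_quadratic h (3 / 2) (- (1 / 2) * u') (- (1 / 2) * v')"
    unfolding kummer_quadratic_def
  proof (intro conjI allI impI)
    fix n :: nat assume n: "n \<ge> 1"
    have "pcong 3 (2 + - (1 / 2) * 2 ^ (n * (p - 1)))
       (2 + (- (1 / 2) + of_nat n * (\<pi> * (- (1 / 2) * u')) + (of_nat n)\<^sup>2 * (\<pi>\<^sup>2 * (- (1 / 2) * v'))))"
      using kq n unfolding kummer_quadratic_def by (intro pcong_add) auto
    thus "pcong 3 (h n) (3 / 2 + of_nat n * (\<pi> * (- (1 / 2) * u')) + (of_nat n)\<^sup>2 * (\<pi>\<^sup>2 * (- (1 / 2) * v')))"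
      by (simp add: heq[OF n] algebra_simps)
  qed (use kq pint_div_small[of 3 "num.Bit0 num.One"] in \<open>auto simp: kummer_quadratic_def\<close>)
  show ?thesis
  proof (rule kummer_quadratic_quotient[OF fh h])
    show "pint (1 / (3 / 2))" using pint_div_small[of 2 "num.Bit1 num.One"] by simp
    show "h n \<noteq> 0 \<and> pint (1 / h n)" if "n \<ge> 1" for n
      using genocchi_factor_unit[OF that, of 2] by (simp add: h_def)
  qed simp
qed

text \<open>Modulo \<open>p\<close>, both sides of the Genocchi congruence are independent of \<open>n\<close> by Fermat's theorem.\<close>

lemma Bd4_kummer:
  assumes "n \<ge> 1" shows "pcong 1 (Bd n 4) (Bd 1 4)"
proof -
  define c :: "nat \<Rightarrow> rat" where "c = (\<lambda>n. 2 * (1 - 2 ^ (n * (p - 1) - 4)))"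
  define S :: "nat \<Rightarrow> rat" where "S = (\<lambda>n. \<Sum>a<p ^ 4. (-1) ^ a * of_nat a ^ (n * (p - 1) - 5))"
  have pw: "pcong 1 (of_nat a ^ (n * (p - 1) - d)) (of_nat a ^ (p - 1 - d))" if "d < p - 1" for a d
  proof -
    have "[int (a ^ (n * (p - 1) - d)) = int (a ^ (p - 1 - d))] (mod int p ^ 1)"
      using fermat_power_minus[OF assms that, of a] by (simp only: cong_int_iff power_one_right)
    thus ?thesis by (simp only: flip: pcong_of_int) simp
  qed
  have S: "pcong 1 (S n) (S 1)"
    unfolding S_def using pw[of 5] p7 by (intro pcong_sum pcong_lmult) auto
  have cS: "pcong 1 (c k * Bd k 4) (S k)" if "k \<ge> 1" for k
    using divided_bernoulli_shift_genocchi[OF that, of 4] unfolding c_def S_def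
    by (auto intro: pcong_weaken)
  have c: "pcong 1 (c n) (c 1)"
    unfolding c_def using pw[of 4 2] p7 by (intro pcong_lmult pcong_diff) auto
  have "pcong 1 (c n * Bd n 4) (c 1 * Bd 1 4)"
    using cS[OF assms] S pcong_sym[OF cS[of 1]] by (blast intro: pcong_trans)
  also have "pcong 1 (c 1 * Bd 1 4) (c n * Bd 1 4)"
    using pcong_lmult[OF pint_Bd[of 1 4] pcong_sym[OF c]] by (simp add: mult.commute)
  finally show ?thesis
    by (rule pcong_cancel_unit) (use genocchi_factor_unit[OF assms, of 4] in \<open>simp_all add: c_def\<close>)
qed

section \<open>Sums of powers of Fermat quotients\<close>

text \<open>Only the terms \<open>k \<le> 4\<close> of the formula for power sums matter modulo \<open>p\<^sup>6\<close>. For \<open>k = 5\<close> the Bernoulli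
  number has odd index, so it is \<open>0\<close> or \<open>-1/2\<close>. For \<open>k \<ge> 6\<close> one factor \<open>p\<close> makes it integral, and
  \<open>p\<^bsup>k-6\<^esup> / (k + 1)\<close> is integral too, with the exception of \<open>k = 6\<close>, \<open>p = 7\<close>. There the binomial
  coefficient supplies the missing factor \<open>7\<close>, except for \<open>n = 1\<close>, where the Bernoulli number is
  \<open>B\<^sub>0 = 1\<close> and the term equals \<open>7\<^sup>6\<close>.\<close>

lemma power_sum_tail:
  assumes n: "n \<in> {1..5}" and k: "k \<ge> 5" "k \<le> n * (p - 1)"
  shows "pcong 6 (of_nat (n * (p - 1) choose k) * \<pi> ^ Suc k / of_nat (Suc k) * bernoulli_number (n * (p - 1) - k)) 0"
proof -
  define m where "m = n * (p - 1)"
  consider (5) "k = 5" | (6) "k = 6" "p = 7" "n = 1" | (gt) "k \<ge> 6" "\<not> (k = 6 \<and> p = 7 \<and> n = 1)"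
    using k(1) by force
  thus ?thesis unfolding m_def[symmetric]
  proof cases
    case 5
    have "even m" unfolding m_def by (rule even_index)
    hence "odd (m - 5)" using k unfolding m_def[symmetric] 5 by presburger
    \<comment> \<open>The index \<open>m - 5\<close> is odd, and equals \<open>1\<close> for \<open>p = 7\<close>, \<open>n = 1\<close>.\<close>
    have "pint (bernoulli_number (m - 5))"
    proof (cases "m - 5 = 1")
      case False
      thus ?thesis using bernoulli_number_odd[OF \<open>odd (m - 5)\<close>] by simp
    next
      case True
      have "pint (- (1 / 2))" using pint_div_small[of 1 "num.Bit0 num.One"] by (intro pint_minus) auto
      thus ?thesis unfolding True bernoulli_number_1 by simp
    qed
    hence *: "pint (of_nat (m choose 5) * bernoulli_number (m - 5) / 6)"
      by (intro pint_div_small pint_mult) auto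
    show "pcong 6 (of_nat (m choose k) * \<pi> ^ Suc k / of_nat (Suc k) * bernoulli_number (m - k)) 0"
      unfolding 5 by (rule pcongI[OF _ *]) (simp add: eval_nat_numeral)
  next
    case 6
    have m: "m = 6" by (simp add: m_def 6)
    show "pcong 6 (of_nat (m choose k) * \<pi> ^ Suc k / of_nat (Suc k) * bernoulli_number (m - k)) 0"
      unfolding m 6(1) by (rule pcongI[where c = 1]) (simp add: 6(2), rule pint_1)
  next
    case gt
    have 1: "pint (of_nat (m choose k) * (\<pi> ^ (k - 6) / of_nat (Suc k)))"
    proof (cases "k = 6 \<and> p = 7")
      case True
      have "n = 2 \<or> n = 3 \<or> n = 4 \<or> n = 5" using n gt True by auto
      hence "m = 12 \<or> m = 18 \<or> m = 24 \<or> m = 30" unfolding m_def using True by auto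
      \<comment> \<open>The four binomial coefficients are 924, 18564, 134596 and 593775.\<close>
      hence "7 dvd (m choose 6)"
        by (elim disjE) (simp_all add: binomial_fact' fact_numeral)
      then obtain c where "m choose 6 = 7 * c" by blast
      hence "of_nat (m choose k) * (\<pi> ^ (k - 6) / of_nat (Suc k)) = (of_nat c :: rat)"
        using True by simp
      thus ?thesis by (simp only: pint_of_nat)
    next
      case False
      have "Suc k < p ^ Suc (k - 6)"
      proof (cases "k = 6")
        case True
        thus ?thesis using False p7 by simp
      next
        case k6: False
        define j where "j = k - 7"
        have kj: "k = j + 7" using gt(1) k6 by (simp add: j_def)
        have "Suc k < 7 ^ (j + 2)"
          unfolding kj by (induction j) auto
        also have "\<dots> \<le> p ^ (j + 2)" using p7 by (intro power_mono) auto
        finally show ?thesis unfolding kj by simp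
      qed
      hence "pint (\<pi> ^ (k - 6) / of_nat (Suc k))" by (intro pint_power_div_small) auto
      thus ?thesis by (rule pint_mult[OF pint_of_nat])
    qed
    have "\<pi> ^ Suc k = \<pi> ^ 6 * \<pi> ^ (k - 6) * \<pi>"
      using gt(1) by (simp flip: power_add power_Suc2)
    thus "pcong 6 (of_nat (m choose k) * \<pi> ^ Suc k / of_nat (Suc k) * bernoulli_number (m - k)) 0"
      by (intro pcongI[OF _ pint_mult[OF 1 pint_p_bernoulli[of "m - k"]]]) simp
  qed
qed

text \<open>With \<open>m = n (p - 1)\<close>, dividing the terms \<open>k = 2\<close> and \<open>k = 4\<close> of the formula for
  \<open>1\<^sup>m + ... + (p-1)\<^sup>m\<close> by \<open>p m\<close> leaves \<open>p\<^sup>2\<close> and \<open>p\<^sup>4\<close> times the following numbers.\<close>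

definition corr2 :: "nat \<Rightarrow> rat" where
  "corr2 n = (of_nat n * (\<pi> - 1) - 1) * (of_nat n * (\<pi> - 1) - 2) / 6 * Bd n 2"

definition corr4 :: "nat \<Rightarrow> rat" where
  "corr4 n = (of_nat n * (\<pi> - 1) - 1) * (of_nat n * (\<pi> - 1) - 2) * (of_nat n * (\<pi> - 1) - 3)
       * (of_nat n * (\<pi> - 1) - 4) / 120 * Bd n 4"

text \<open>The sum \<open>1\<^sup>m + ... + (p-1)\<^sup>m\<close>, \<open>m = n (p - 1)\<close>, in excess of the value \<open>p - 1\<close> that Fermat's theorem
  gives modulo \<open>p\<close>.\<close>

definition pow_excess :: "nat \<Rightarrow> rat" where
  "pow_excess n = (\<Sum>a\<in>{1..<p}. of_nat a ^ (n * (p - 1)) - 1)"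

lemma choose_2_rat: "of_nat (m choose 2) = of_nat m * (of_nat m - 1) / (2 :: rat)"
  by (simp add: binomial_gbinomial gbinomial_prod_rev eval_nat_numeral)

lemma choose_4_rat:
  "of_nat (m choose 4) = of_nat m * (of_nat m - 1) * (of_nat m - 2) * (of_nat m - 3) / (24 :: rat)"
  by (simp add: binomial_gbinomial gbinomial_prod_rev eval_nat_numeral mult_ac)

text \<open>The summand \<open>1/p - 1\<close> in the numerator of \<open>B\<^sub>n\<close> turns \<open>p\<close> times that numerator into
  \<open>p B\<^sub>m - (p - 1)\<close>, so it is the excess that has \<open>p m B\<^sub>n\<close> as its leading term.\<close>

lemma pow_excess_expansion:
  assumes n: "n \<in> {1..5}"
  shows "pcong 6 (pow_excess n) (\<pi> * (of_nat n * (\<pi> - 1)) * (B n + \<pi>\<^sup>2 * corr2 n + \<pi> ^ 4 * corr4 n))"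
proof -
  define m where "m = n * (p - 1)"
  have n1: "n \<ge> 1" using n by auto
  have m6: "m \<ge> 6" unfolding m_def by (rule index_ge_6[OF n1])
  have me: "even m" unfolding m_def by (rule even_index)
  define T where "T = (\<lambda>k. of_nat (m choose k) * \<pi> ^ Suc k / of_nat (Suc k) * bernoulli_number (m - k))"
  have T: "pcong 6 (T k) (if k \<in> {0, 2, 4} then T k else 0)" if "k \<le> m" for k
  proof -
    consider "k \<in> {0, 2, 4}" | "k = 1 \<or> k = 3" | "k \<ge> 5" by force
    thus ?thesis
    proof cases
      case 2
      hence "bernoulli_number (m - k) = 0" using m6 me by (intro bernoulli_number_odd) auto
      thus ?thesis by (auto simp: T_def)
    next
      case 3
      thus ?thesis using power_sum_tail[OF n 3] that by (auto simp: T_def m_def)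
    qed auto
  qed
  have "(\<Sum>a<p. of_nat a ^ m) = (\<Sum>k\<le>m. T k)"
    unfolding T_def by (rule sum_powers_bernoulli)
  also have "pcong 6 \<dots> (\<Sum>k\<le>m. if k \<in> {0, 2, 4} then T k else 0)"
    by (intro pcong_sum T) auto
  also have "(\<Sum>k\<le>m. if k \<in> {0, 2, 4} then T k else 0) = (\<Sum>k\<in>{0, 2, 4}. T k)"
    using m6 by (intro sum.mono_neutral_cong_right) auto
  also have "\<dots> = \<pi> * bernoulli_number m + \<pi> ^ 3 * of_nat (m choose 2) / 3 * bernoulli_number (m - 2)
      + \<pi> ^ 5 * of_nat (m choose 4) / 5 * bernoulli_number (m - 4)"
    by (simp add: T_def eval_nat_numeral mult_ac)
  finally have main: "pcong 6 (\<Sum>a<p. of_nat a ^ m) \<dots>" .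
  have "{..<p} = insert 0 {1..<p}" using p7 by auto
  hence "(\<Sum>a<p. of_nat a ^ m) = (\<Sum>a\<in>{1..<p}. of_nat a ^ m :: rat)"
    using m6 by simp
  also have "\<dots> = pow_excess n + (\<pi> - 1)"
    unfolding pow_excess_def m_def[symmetric] using p7 by (simp add: sum_subtractf of_nat_diff)
  finally have pow_excess: "pow_excess n = (\<Sum>a<p. of_nat a ^ m) - (\<pi> - 1)" by simp
  define M :: rat where "M = of_nat m"
  have M: "M = of_nat n * (\<pi> - 1)" unfolding M_def m_def by (rule of_nat_index)
  have Mnz: "M \<noteq> 0" "M - 2 \<noteq> 0" "M - 4 \<noteq> 0" using m6 by (auto simp: M_def)
  have b0: "bernoulli_number m = M * B n - 1 / \<pi> + 1"
    unfolding divided_bernoulli_def m_def[symmetric] M_def[symmetric] using Mnz by simp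
  have b2: "bernoulli_number (m - 2) = (M - 2) * Bd n 2"
    unfolding divided_bernoulli_shift_def m_def[symmetric] using Mnz m6 by (simp add: M_def of_nat_diff)
  have b4: "bernoulli_number (m - 4) = (M - 4) * Bd n 4"
    unfolding divided_bernoulli_shift_def m_def[symmetric] using Mnz m6 by (simp add: M_def of_nat_diff)
  have corr2: "corr2 n = (M - 1) * (M - 2) / 6 * Bd n 2" by (simp add: corr2_def M)
  have corr4: "corr4 n = (M - 1) * (M - 2) * (M - 3) * (M - 4) / 120 * Bd n 4" by (simp add: corr4_def M)
  have "pcong 6 (pow_excess n) (\<pi> * bernoulli_number m + \<pi> ^ 3 * of_nat (m choose 2) / 3 * bernoulli_number (m - 2)
      + \<pi> ^ 5 * of_nat (m choose 4) / 5 * bernoulli_number (m - 4) - (\<pi> - 1))"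
    unfolding pow_excess by (intro pcong_diff main) auto
  also have "\<dots> = \<pi> * M * (B n + \<pi>\<^sup>2 * corr2 n + \<pi> ^ 4 * corr4 n)"
    unfolding choose_2_rat choose_4_rat M_def[symmetric] b0 b2 b4 corr2 corr4
      power_Suc[of \<pi> 2, simplified] power_Suc[of \<pi> 4, simplified]
    by (simp add: field_simps)
  finally show ?thesis by (simp only: M)
qed

lemma pint_div_120: "pint a \<Longrightarrow> pint (a / 120)"
proof -
  assume "pint a"
  hence "pint (a / 4 / 5 / 6)" by (intro pint_div_small) auto
  thus ?thesis by simp
qed

lemma pint_corr4: "n \<ge> 1 \<Longrightarrow> pint (corr4 n)"
  using pint_Bd[of n 4] unfolding corr4_def by (intro pint_mult pint_div_120 pint_diff) auto

text \<open>Power sums of the Fermat quotients \<open>q\<^sub>a = (a\<^bsup>p-1\<^esup> - 1) / p\<close>.\<close>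

definition fq_moment :: "nat \<Rightarrow> rat" where
  "fq_moment k = (\<Sum>a\<in>{1..<p}. ((of_nat a ^ (p - 1) - 1) / \<pi>) ^ k)"

lemma pint_fermat_quotient:
  assumes "a \<in> {1..<p}" shows "pint ((of_nat a ^ (p - 1) - 1) / \<pi>)"
proof -
  have "\<not> p dvd a" using assms by (auto dest: dvd_imp_le)
  hence "[int (a ^ (p - 1)) = int 1] (mod int p ^ 1)"
    using fermat_theorem[OF p, of a] by (simp only: cong_int_iff power_one_right not_False_eq_True)
  hence "pcong 1 (of_nat a ^ (p - 1)) 1"
    by (simp only: flip: pcong_of_int) simp
  thus ?thesis by (simp add: pcong_def)
qed

lemma pint_fq_moment: "pint (fq_moment k)"
  unfolding fq_moment_def by (intro pint_sum pint_power pint_fermat_quotient)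

text \<open>These are the binomial expansions of \<open>(1 + p q\<^sub>a)\<^sup>n - 1\<close>, summed over \<open>a\<close>, so the \<open>k\<close>th difference
  of the excess at \<open>n = 0\<close> is \<open>p\<^sup>k\<close> times the \<open>k\<close>th moment of the Fermat quotients.\<close>

lemma pow_excess_moments:
  "pow_excess 1 = \<pi> * fq_moment 1"
  "pow_excess 2 = 2 * \<pi> * fq_moment 1 + \<pi>\<^sup>2 * fq_moment 2"
  "pow_excess 3 = 3 * \<pi> * fq_moment 1 + 3 * \<pi>\<^sup>2 * fq_moment 2 + \<pi> ^ 3 * fq_moment 3"
  "pow_excess 4 = 4 * \<pi> * fq_moment 1 + 6 * \<pi>\<^sup>2 * fq_moment 2 + 4 * \<pi> ^ 3 * fq_moment 3 + \<pi> ^ 4 * fq_moment 4"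
  "pow_excess 5 = 5 * \<pi> * fq_moment 1 + 10 * \<pi>\<^sup>2 * fq_moment 2 + 10 * \<pi> ^ 3 * fq_moment 3 + 5 * \<pi> ^ 4 * fq_moment 4 + \<pi> ^ 5 * fq_moment 5"
proof -
  define q :: "nat \<Rightarrow> rat" where "q = (\<lambda>a. (of_nat a ^ (p - 1) - 1) / \<pi>)"
  have "of_nat a ^ (p - 1) = 1 + \<pi> * q a" for a by (simp add: q_def)
  hence "of_nat a ^ (n * (p - 1)) = (1 + \<pi> * q a) ^ n" for a n
    by (metis power_mult mult.commute)
  hence pow_excess: "pow_excess n = (\<Sum>a\<in>{1..<p}. (1 + \<pi> * q a) ^ n - 1)" for n
    by (simp only: pow_excess_def)
  have fq_moment: "fq_moment k = (\<Sum>a\<in>{1..<p}. q a ^ k)" for k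
    by (simp only: fq_moment_def q_def)
  show "pow_excess 1 = \<pi> * fq_moment 1"
    by (simp add: pow_excess fq_moment sum_distrib_left)
  show "pow_excess 2 = 2 * \<pi> * fq_moment 1 + \<pi>\<^sup>2 * fq_moment 2"
    unfolding pow_excess fq_moment sum_distrib_left sum.distrib[symmetric]
    by (intro sum.cong refl) (simp add: eval_nat_numeral algebra_simps)
  show "pow_excess 3 = 3 * \<pi> * fq_moment 1 + 3 * \<pi>\<^sup>2 * fq_moment 2 + \<pi> ^ 3 * fq_moment 3"
    unfolding pow_excess fq_moment sum_distrib_left sum.distrib[symmetric]
    by (intro sum.cong refl) (simp add: eval_nat_numeral algebra_simps)
  show "pow_excess 4 = 4 * \<pi> * fq_moment 1 + 6 * \<pi>\<^sup>2 * fq_moment 2 + 4 * \<pi> ^ 3 * fq_moment 3 + \<pi> ^ 4 * fq_moment 4"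
    unfolding pow_excess fq_moment sum_distrib_left sum.distrib[symmetric]
    by (intro sum.cong refl) (simp add: eval_nat_numeral algebra_simps)
  show "pow_excess 5 = 5 * \<pi> * fq_moment 1 + 10 * \<pi>\<^sup>2 * fq_moment 2 + 10 * \<pi> ^ 3 * fq_moment 3 + 5 * \<pi> ^ 4 * fq_moment 4 + \<pi> ^ 5 * fq_moment 5"
    unfolding pow_excess fq_moment sum_distrib_left sum.distrib[symmetric]
    by (intro sum.cong refl) (simp add: eval_nat_numeral algebra_simps)
qed

lemma pint_inverse_p_minus_1: "pint (1 / (\<pi> - 1))" and p_minus_1_nz: "\<pi> - 1 \<noteq> 0"
proof -
  have "\<not> p dvd p - 1" using p7 by (auto dest: dvd_imp_le)
  hence "\<not> int p dvd int (p - 1)" by (simp only: int_dvd_int_iff not_False_eq_True)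
  from pint_inverse_of_int[OF this] show "pint (1 / (\<pi> - 1))" using p7 by (simp add: of_nat_diff)
  show "\<pi> - 1 \<noteq> 0" using p7 by simp
qed

lemma pcong_cancel_p_minus_1: "pcong k ((\<pi> - 1) * a) ((\<pi> - 1) * b) \<Longrightarrow> pcong k a b"
  by (rule pcong_cancel_unit[OF _ pint_inverse_p_minus_1 p_minus_1_nz])

text \<open>Here \<open>x\<close> is the value at \<open>n = 0\<close> of the quadratic polynomial that represents the sequence, so the
  third difference formula extrapolates it from the values at \<open>1\<close>, \<open>2\<close> and \<open>3\<close>.\<close>

lemma Bd2_expansion:
  obtains x u v where "pint x" "pint u" "pint v"
    "\<And>n. n \<ge> 1 \<Longrightarrow> pcong 3 (Bd n 2) (x + of_nat n * (\<pi> * u) + (of_nat n)\<^sup>2 * (\<pi>\<^sup>2 * v))"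
    "pcong 3 (3 * Bd 1 2 - 3 * Bd 2 2 + Bd 3 2) x"
    "\<And>n. n \<ge> 1 \<Longrightarrow> pcong 3 (corr2 n) ((of_nat n * (\<pi> - 1) - 1) * (of_nat n * (\<pi> - 1) - 2) / 6
        * (x + of_nat n * (\<pi> * u) + (of_nat n)\<^sup>2 * (\<pi>\<^sup>2 * v)))"
proof -
  obtain x u v where "kummer_quadratic (\<lambda>n. Bd n 2) x u v" using Bd2_kummer by blast
  hence *: "pint x" "pint u" "pint v"
    "\<And>n. n \<ge> 1 \<Longrightarrow> pcong 3 (Bd n 2) (x + of_nat n * (\<pi> * u) + (of_nat n)\<^sup>2 * (\<pi>\<^sup>2 * v))"
    by (auto simp: kummer_quadratic_def)
  have "pcong 3 (3 * Bd 1 2 - 3 * Bd 2 2 + Bd 3 2)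
      (3 * (x + of_nat 1 * (\<pi> * u) + (of_nat 1)\<^sup>2 * (\<pi>\<^sup>2 * v)) -
       3 * (x + of_nat 2 * (\<pi> * u) + (of_nat 2)\<^sup>2 * (\<pi>\<^sup>2 * v)) +
       (x + of_nat 3 * (\<pi> * u) + (of_nat 3)\<^sup>2 * (\<pi>\<^sup>2 * v)))"
    by (intro pcong_add pcong_diff pcong_lmult *(4)) auto
  also have "\<dots> = x" by (simp add: algebra_simps)
  finally have d: "pcong 3 (3 * Bd 1 2 - 3 * Bd 2 2 + Bd 3 2) x" .
  have "pcong 3 (corr2 n) ((of_nat n * (\<pi> - 1) - 1) * (of_nat n * (\<pi> - 1) - 2) / 6
        * (x + of_nat n * (\<pi> * u) + (of_nat n)\<^sup>2 * (\<pi>\<^sup>2 * v)))" if "n \<ge> 1" for n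
    unfolding corr2_def
    by (intro pcong_lmult *(4) that pint_div_small pint_mult pint_diff) auto
  with * d show ?thesis by (rule that)
qed

text \<open>The differences of \<open>B\<^sub>n\<close> at \<open>n = 1\<close>. Since
  \<open>(n choose k) / n = ((n-1) choose (k-1)) / k\<close>, the excess divided by \<open>n p\<close> has there, as its \<open>k\<close>th
  difference, the \<open>(k + 1)\<close>st moment times \<open>p\<^sup>k / (k + 1)\<close>. Modulo \<open>p\<^sup>5\<close> it equals \<open>p - 1\<close> times the sum of
  \<open>B\<^sub>n\<close> and two corrections. The correction of weight \<open>p\<^sup>2\<close> is a quadratic polynomial in \<open>n\<close> times
  \<open>B\<^bsub>n,2\<^esub>\<close>, so each of its differences beyond the second gains a factor \<open>p\<close> from Kummer's congruences for \<open>B\<^bsub>n,2\<^esub>\<close>; for that of weight \<open>p\<^sup>4\<close> integrality suffices.\<close>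

lemma divided_bernoulli_kummer:
  "pint (B 1)" "pcong 1 (B 2 - B 1) 0" "pcong 2 (B 3 - 2 * B 2 + B 1) 0"
  "pcong 3 (B 4 - 3 * B 3 + 3 * B 2 - B 1) 0"
  "pcong 4 (B 5 - 4 * B 4 + 6 * B 3 - 4 * B 2 + B 1) 0"
proof -
  obtain x u v where xuv: "pint x" "pint u" "pint v" and
    corr2: "\<And>n. n \<ge> 1 \<Longrightarrow> pcong 3 (corr2 n) ((of_nat n * (\<pi> - 1) - 1) * (of_nat n * (\<pi> - 1) - 2) / 6
        * (x + of_nat n * (\<pi> * u) + (of_nat n)\<^sup>2 * (\<pi>\<^sup>2 * v)))"
    using Bd2_expansion by metis
  define P where "P n = (of_nat n * (\<pi> - 1) - 1) * (of_nat n * (\<pi> - 1) - 2) / 6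
        * (x + of_nat n * (\<pi> * u) + (of_nat n)\<^sup>2 * (\<pi>\<^sup>2 * v))" for n :: nat
  have P: "pint (P n)" for n
    unfolding P_def by (intro pint_mult pint_div_small pint_diff pint_add pint_power xuv) auto
  define c where "c = \<pi> - 1"
  have pc: "pint c" by (simp add: c_def)
  have "\<exists>e. pint e \<and> c * B n = pow_excess n / (of_nat n * \<pi>) - c * \<pi>\<^sup>2 * P n - c * \<pi> ^ 4 * corr4 n + \<pi> ^ 5 * e"
    if n: "n \<in> {1..5}" for n
  proof -
    obtain e where e: "pint e" "pow_excess n = \<pi> * (of_nat n * c) * (B n + \<pi>\<^sup>2 * corr2 n + \<pi> ^ 4 * corr4 n) + \<pi> ^ 6 * e"
      using pow_excess_expansion[OF n] by (auto simp: c_def elim: pcongE)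
    obtain a where a: "pint a" "corr2 n = P n + \<pi> ^ 3 * a"
      using corr2[of n] n by (auto simp: P_def elim: pcongE)
    have "\<not> p dvd n" using n by (intro p_not_dvd) auto
    hence "\<not> int p dvd int n" by (simp only: int_dvd_int_iff not_False_eq_True)
    from pint_divide[OF e(1) this] have "pint (- (e / of_nat n) - c * a)"
      using a pc by (intro pint_diff pint_minus pint_mult) auto
    moreover have "c * B n = pow_excess n / (of_nat n * \<pi>) - c * \<pi>\<^sup>2 * P n - c * \<pi> ^ 4 * corr4 n
        + \<pi> ^ 5 * (- (e / of_nat n) - c * a)"
      unfolding e(2) a(2) using n by (simp add: field_simps) (simp add: eval_nat_numeral algebra_simps)
    ultimately show ?thesis by blast
  qed
  then obtain e where e: "\<And>n. n \<in> {1..5} \<Longrightarrow> pint (e n)" and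
    cB: "\<And>n. n \<in> {1..5} \<Longrightarrow> c * B n = pow_excess n / (of_nat n * \<pi>) - c * \<pi>\<^sup>2 * P n - c * \<pi> ^ 4 * corr4 n + \<pi> ^ 5 * e n"
    by metis
  have pe: "pint (e 1)" "pint (e 2)" "pint (e 3)" "pint (e 4)" "pint (e 5)" using e by auto
  have pC: "pint (corr4 n)" if "n \<ge> 1" for n using pint_corr4 that by auto
  have G: "pow_excess 1 / \<pi> = fq_moment 1" "pow_excess 2 / (2 * \<pi>) = fq_moment 1 + \<pi> * fq_moment 2 / 2"
    "pow_excess 3 / (3 * \<pi>) = fq_moment 1 + \<pi> * fq_moment 2 + \<pi>\<^sup>2 * fq_moment 3 / 3"
    "pow_excess 4 / (4 * \<pi>) = fq_moment 1 + 3 * \<pi> * fq_moment 2 / 2 + \<pi>\<^sup>2 * fq_moment 3 + \<pi> ^ 3 * fq_moment 4 / 4"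
    "pow_excess 5 / (5 * \<pi>) = fq_moment 1 + 2 * \<pi> * fq_moment 2 + 2 * \<pi>\<^sup>2 * fq_moment 3 + \<pi> ^ 3 * fq_moment 4 + \<pi> ^ 4 * fq_moment 5 / 5"
    unfolding pow_excess_moments by (simp_all add: field_simps power_numeral_reduce)
  have B1: "c * B 1 = fq_moment 1 - c * \<pi>\<^sup>2 * P 1 - c * \<pi> ^ 4 * corr4 1 + \<pi> ^ 5 * e 1"
    using cB[of 1] G(1) by simp
  have B2: "c * B 2 = fq_moment 1 + \<pi> * fq_moment 2 / 2 - c * \<pi>\<^sup>2 * P 2 - c * \<pi> ^ 4 * corr4 2 + \<pi> ^ 5 * e 2"
    using cB[of 2] G(2) by simp
  have B3: "c * B 3 = fq_moment 1 + \<pi> * fq_moment 2 + \<pi>\<^sup>2 * fq_moment 3 / 3 - c * \<pi>\<^sup>2 * P 3 - c * \<pi> ^ 4 * corr4 3 + \<pi> ^ 5 * e 3"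
    using cB[of 3] G(3) by simp
  have B4: "c * B 4 = fq_moment 1 + 3 * \<pi> * fq_moment 2 / 2 + \<pi>\<^sup>2 * fq_moment 3 + \<pi> ^ 3 * fq_moment 4 / 4
      - c * \<pi>\<^sup>2 * P 4 - c * \<pi> ^ 4 * corr4 4 + \<pi> ^ 5 * e 4"
    using cB[of 4] G(4) by simp
  have B5: "c * B 5 = fq_moment 1 + 2 * \<pi> * fq_moment 2 + 2 * \<pi>\<^sup>2 * fq_moment 3 + \<pi> ^ 3 * fq_moment 4 + \<pi> ^ 4 * fq_moment 5 / 5
      - c * \<pi>\<^sup>2 * P 5 - c * \<pi> ^ 4 * corr4 5 + \<pi> ^ 5 * e 5"
    using cB[of 5] G(5) by simp
  \<comment> \<open>The third and fourth differences of the quartic polynomial that represents the correction.\<close>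
  have P3: "P 4 - 3 * P 3 + 3 * P 2 - P 1 = \<pi> * (c\<^sup>2 * u - 3 * c * \<pi> * v + 10 * \<pi> * c\<^sup>2 * v)"
    unfolding P_def c_def by (simp add: field_simps power2_eq_square)
  have P4: "P 5 - 4 * P 4 + 6 * P 3 - 4 * P 2 + P 1 = \<pi>\<^sup>2 * (4 * c\<^sup>2 * v)"
    unfolding P_def c_def by (simp add: field_simps power2_eq_square)
  have "pint (c * B 1)"
    unfolding B1 by (intro pint_add pint_diff pint_mult pint_power pint_fq_moment P pC pe pc) auto
  from pint_mult[OF pint_inverse_p_minus_1 this] show "pint (B 1)"
    using p_minus_1_nz by (simp add: c_def)
  have cancel: "pcong k a 0" if "c * a = \<pi> ^ k * b" "pint b" for k a b
    by (rule pcong_cancel_p_minus_1) (rule pcongI[of _ _ _ b], use that in \<open>simp_all add: c_def\<close>)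
  show "pcong 1 (B 2 - B 1) 0"
  proof (rule cancel)
    have "c * (B 2 - B 1) = c * B 2 - c * B 1" by (simp add: algebra_simps)
    also have "\<dots> = \<pi> ^ 1 * (fq_moment 2 / 2 - c * \<pi> * (P 2 - P 1) - c * \<pi> ^ 3 * (corr4 2 - corr4 1) + \<pi> ^ 4 * (e 2 - e 1))"
      unfolding B1 B2 by (simp add: algebra_simps eval_nat_numeral)
    finally show "c * (B 2 - B 1) = \<dots>" .
  qed (intro pint_add pint_diff pint_mult pint_power pint_fq_moment P pC pe pc pint_div_small; simp)
  show "pcong 2 (B 3 - 2 * B 2 + B 1) 0"
  proof (rule cancel)
    have "c * (B 3 - 2 * B 2 + B 1) = c * B 3 - 2 * (c * B 2) + c * B 1" by (simp add: algebra_simps)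
    also have "\<dots> = \<pi> ^ 2 * (fq_moment 3 / 3 - c * (P 3 - 2 * P 2 + P 1) - c * \<pi>\<^sup>2 * (corr4 3 - 2 * corr4 2 + corr4 1)
         + \<pi> ^ 3 * (e 3 - 2 * e 2 + e 1))"
      unfolding B1 B2 B3 by (simp add: field_simps)
    finally show "c * (B 3 - 2 * B 2 + B 1) = \<dots>" .
  qed (intro pint_add pint_diff pint_mult pint_power pint_fq_moment P pC pe pc pint_div_small; simp)
  show "pcong 3 (B 4 - 3 * B 3 + 3 * B 2 - B 1) 0"
  proof (rule cancel)
    have "c * (B 4 - 3 * B 3 + 3 * B 2 - B 1) = c * B 4 - 3 * (c * B 3) + 3 * (c * B 2) - c * B 1"
      by (simp add: algebra_simps)
    also have "\<dots> = \<pi> ^ 3 * fq_moment 4 / 4 - c * \<pi>\<^sup>2 * (P 4 - 3 * P 3 + 3 * P 2 - P 1)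
         - c * \<pi> ^ 4 * (corr4 4 - 3 * corr4 3 + 3 * corr4 2 - corr4 1) + \<pi> ^ 5 * (e 4 - 3 * e 3 + 3 * e 2 - e 1)"
      unfolding B1 B2 B3 B4 by (simp add: algebra_simps)
    also have "\<dots> = \<pi> ^ 3 * (fq_moment 4 / 4 - c * (c\<^sup>2 * u - 3 * c * \<pi> * v + 10 * \<pi> * c\<^sup>2 * v)
         - c * \<pi> * (corr4 4 - 3 * corr4 3 + 3 * corr4 2 - corr4 1) + \<pi>\<^sup>2 * (e 4 - 3 * e 3 + 3 * e 2 - e 1))"
      unfolding P3 by (simp add: algebra_simps eval_nat_numeral)
    finally show "c * (B 4 - 3 * B 3 + 3 * B 2 - B 1) = \<dots>" .
  qed (intro pint_add pint_diff pint_mult pint_power pint_fq_moment P pC pe pc xuv pint_div_small; simp)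
  show "pcong 4 (B 5 - 4 * B 4 + 6 * B 3 - 4 * B 2 + B 1) 0"
  proof (rule cancel)
    have "c * (B 5 - 4 * B 4 + 6 * B 3 - 4 * B 2 + B 1)
        = c * B 5 - 4 * (c * B 4) + 6 * (c * B 3) - 4 * (c * B 2) + c * B 1"
      by (simp add: algebra_simps)
    also have "\<dots> = \<pi> ^ 4 * fq_moment 5 / 5 - c * \<pi>\<^sup>2 * (P 5 - 4 * P 4 + 6 * P 3 - 4 * P 2 + P 1)
         - c * \<pi> ^ 4 * (corr4 5 - 4 * corr4 4 + 6 * corr4 3 - 4 * corr4 2 + corr4 1)
         + \<pi> ^ 5 * (e 5 - 4 * e 4 + 6 * e 3 - 4 * e 2 + e 1)"
      unfolding B1 B2 B3 B4 B5 by (simp add: algebra_simps)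
    also have "\<dots> = \<pi> ^ 4 * (fq_moment 5 / 5 - c * (4 * c\<^sup>2 * v)
         - c * (corr4 5 - 4 * corr4 4 + 6 * corr4 3 - 4 * corr4 2 + corr4 1) + \<pi> * (e 5 - 4 * e 4 + 6 * e 3 - 4 * e 2 + e 1))"
      unfolding P4 by (simp add: algebra_simps eval_nat_numeral)
    finally show "c * (B 5 - 4 * B 4 + 6 * B 3 - 4 * B 2 + B 1) = \<dots>" .
  qed (intro pint_add pint_diff pint_mult pint_power pint_fq_moment P pC pe pc xuv pint_div_small; simp)
qed

end

section \<open>The truncated logarithm and exponential\<close>

definition trunc_log :: "rat \<Rightarrow> rat" where
  "trunc_log x = x - x\<^sup>2 / 2 + x ^ 3 / 3 - x ^ 4 / 4 + x ^ 5 / 5"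

definition trunc_exp :: "rat \<Rightarrow> rat" where
  "trunc_exp y = 1 + y + y\<^sup>2 / 2 + y ^ 3 / 6 + y ^ 4 / 24 + y ^ 5 / 120"

text \<open>The coefficient of \<open>y\<^sup>n - 1\<close> is \<open>(-1)\<^bsup>n-1\<^esup> (5 choose n) / n\<close>. Its denominator cancels against the
  factor \<open>n\<close> of the exponents \<open>n (p - 1)\<close>, which leaves the weights of an extrapolation to \<open>n = 0\<close>.\<close>

lemma trunc_log_powers:
  "trunc_log (y - 1) = 5 * (y - 1) - 5 * (y\<^sup>2 - 1) + 10 / 3 * (y ^ 3 - 1) - 5 / 4 * (y ^ 4 - 1) + 1 / 5 * (y ^ 5 - 1)"
proof -
  have "60 * trunc_log (y - 1) = 60 * (5 * (y - 1) - 5 * (y\<^sup>2 - 1) + 10 / 3 * (y ^ 3 - 1)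
      - 5 / 4 * (y ^ 4 - 1) + 1 / 5 * (y ^ 5 - 1))"
    unfolding trunc_log_def by (simp add: algebra_simps eval_nat_numeral add_divide_distrib diff_divide_distrib)
  thus ?thesis unfolding mult_cancel_left by simp
qed

context prime_at_least_7
begin

text \<open>The functional equation of the logarithm holds for the truncation up to terms of total degree at
  least six in \<open>a - 1\<close> and \<open>b - 1\<close>; \<open>R\<close> collects these.\<close>

lemma trunc_log_mult:
  assumes "pcong 1 a 1" "pcong 1 b 1"
  shows "pcong 6 (trunc_log (a * b - 1)) (trunc_log (a - 1) + trunc_log (b - 1))"
proof -
  obtain X Y where XY: "pint X" "pint Y" "a = 1 + \<pi> * X" "b = 1 + \<pi> * Y"
    using assms by (auto elim!: pcongE)
  define R where "R = X * Y ^ 5 + 5 * X ^ 2 * Y ^ 4 / 2 + 2 * X ^ 2 * Y ^ 5 * \<pi> + 10 * X ^ 3 * Y ^ 3 / 3 + 5 * X ^ 3 * Y ^ 4 * \<pi> + 2 * X ^ 3 * Y ^ 5 * \<pi> ^ 2 + 5 * X ^ 4 * Y ^ 2 / 2 + 5 * X ^ 4 * Y ^ 3 * \<pi> + 15 * X ^ 4 * Y ^ 4 * \<pi> ^ 2 / 4 + X ^ 4 * Y ^ 5 * \<pi> ^ 3 + X ^ 5 * Y + 2 * X ^ 5 * Y ^ 2 * \<pi> + 2 * X ^ 5 * Y ^ 3 * \<pi> ^ 2 + X ^ 5 * Y ^ 4 * \<pi> ^ 3 + X ^ 5 * Y ^ 5 * \<pi> ^ 4 / 5"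
  have "pint R"
    unfolding R_def by (intro pint_add pint_diff pint_div_small pint_mult pint_power XY) auto
  moreover have "trunc_log (a * b - 1) - (trunc_log (a - 1) + trunc_log (b - 1)) = \<pi> ^ 6 * R"
    unfolding XY trunc_log_def R_def by (simp add: field_simps) (simp add: eval_nat_numeral algebra_simps)
  ultimately show ?thesis by (intro pcongI)
qed

lemma trunc_log_prod:
  assumes "finite I" "\<And>i. i \<in> I \<Longrightarrow> pcong 1 (f i) 1"
  shows "pcong 1 (\<Prod>i\<in>I. f i) 1 \<and> pcong 6 (trunc_log ((\<Prod>i\<in>I. f i) - 1)) (\<Sum>i\<in>I. trunc_log (f i - 1))"
  using assms
proof (induction I rule: finite_induct)
  case empty
  show ?case by (simp add: trunc_log_def)
next
  case (insert i I)
  have 1: "pcong 1 (f i) 1" and IH: "pcong 1 (\<Prod>i\<in>I. f i) 1"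
     "pcong 6 (trunc_log ((\<Prod>i\<in>I. f i) - 1)) (\<Sum>i\<in>I. trunc_log (f i - 1))"
    using insert by auto
  have "pcong 1 (f i * (\<Prod>i\<in>I. f i)) 1" using pcong_mult[OF 1 IH(1)] by simp
  moreover have "pcong 6 (trunc_log (f i * (\<Prod>i\<in>I. f i) - 1)) (trunc_log (f i - 1) + (\<Sum>i\<in>I. trunc_log (f i - 1)))"
    using trunc_log_mult[OF 1 IH(1)] pcong_add[OF pcong_refl IH(2)] by (rule pcong_trans)
  ultimately show ?case using insert by simp
qed

lemma trunc_exp_cong:
  assumes "pcong 6 y z" "pint z" shows "pcong 6 (trunc_exp y) (trunc_exp z)"
proof -
  have "pcong 6 (120 * trunc_exp y) (120 * trunc_exp z)"
  proof -
    have e: "120 * trunc_exp y = 120 + 120 * y + 60 * y\<^sup>2 + 20 * y ^ 3 + 5 * y ^ 4 + y ^ 5" for y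
      by (simp add: trunc_exp_def field_simps)
    show ?thesis unfolding e
      by (intro pcong_add pcong_lmult pcong_power pcong_refl assms) auto
  qed
  moreover have "pint (1 / 120)" using pint_div_120[of 1] by simp
  ultimately show ?thesis by (rule pcong_cancel_unit) simp
qed

text \<open>As \<open>exp (log (1 + x)) = 1 + x\<close>, the truncations compose to \<open>1 + x\<close> up to terms of degree at least six,
  and \<open>x = a - 1\<close> is divisible by \<open>p\<close>.\<close>

lemma trunc_exp_log:
  assumes "pcong 1 a 1" shows "pcong 6 (trunc_exp (trunc_log (a - 1))) a"
proof -
  obtain X where X: "pint X" "a = 1 + \<pi> * X" using assms by (auto elim!: pcongE)
  define x where "x = \<pi> * X"
  have px: "pint x" using X by (simp add: x_def)
  define l where "l = 60 * x - 30 * x ^ 2 + 20 * x ^ 3 - 15 * x ^ 4 + 12 * x ^ 5"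
  have l: "l = 60 * trunc_log x" by (simp add: l_def trunc_log_def)
  have pl: "pint l" unfolding l_def using px by simp
  \<comment> \<open>The powers of the logarithm without their terms of degree six and higher, each obtained
    from the previous one; the factor 60 clears the denominators.\<close>
  have step: "pcong 6 (l ^ Suc k) t'" if "pcong 6 (l ^ k) t" "l * t - t' = x ^ 6 * R" "pint R" for k t t' R
  proof -
    have "pcong 6 (l * l ^ k) (l * t)" by (rule pcong_lmult[OF pl that(1)])
    also have "pcong 6 (l * t) t'"
      by (rule pcongI[of _ _ _ "X ^ 6 * R"]) (use that X in \<open>simp_all add: x_def power_mult_distrib\<close>)
    finally show ?thesis by simp
  qed
  have L1: "pcong 6 (l ^ 1) (60 * x - 30 * x ^ 2 + 20 * x ^ 3 - 15 * x ^ 4 + 12 * x ^ 5)"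
    by (simp add: l_def)
  have L2: "pcong 6 (l ^ 2) (3600 * x ^ 2 - 3600 * x ^ 3 + 3300 * x ^ 4 - 3000 * x ^ 5)"
  proof -
    have "pcong 6 (l ^ Suc 1) (3600 * x ^ 2 - 3600 * x ^ 3 + 3300 * x ^ 4 - 3000 * x ^ 5)"
    proof (rule step[OF L1])
      show "l * (60 * x - 30 * x ^ 2 + 20 * x ^ 3 - 15 * x ^ 4 + 12 * x ^ 5) - (3600 * x ^ 2 - 3600 * x ^ 3 + 3300 * x ^ 4 - 3000 * x ^ 5) = x ^ 6 *
        (2740 - 1320 * x + 705 * x ^ 2 - 360 * x ^ 3 + 144 * x ^ 4)"
        unfolding l_def by (simp add: algebra_simps eval_nat_numeral)
    qed (use px in simp_all)
    thus ?thesis by (simp add: power2_eq_square)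
  qed
  have L3: "pcong 6 (l ^ 3) (216000 * x ^ 3 - 324000 * x ^ 4 + 378000 * x ^ 5)"
  proof -
    have "pcong 6 (l ^ Suc 2) (216000 * x ^ 3 - 324000 * x ^ 4 + 378000 * x ^ 5)"
    proof (rule step[OF L2])
      show "l * (3600 * x ^ 2 - 3600 * x ^ 3 + 3300 * x ^ 4 - 3000 * x ^ 5) - (216000 * x ^ 3 - 324000 * x ^ 4 + 378000 * x ^ 5) = x ^ 6 *
        (- (405000) + 253200 * x - 152700 * x ^ 2 + 84600 * x ^ 3 - 36000 * x ^ 4)"
        unfolding l_def by (simp add: algebra_simps eval_nat_numeral)
    qed (use px in simp_all)
    thus ?thesis by (simp add: power2_eq_square)
  qed
  have L4: "pcong 6 (l ^ 4) (12960000 * x ^ 4 - 25920000 * x ^ 5)"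
  proof -
    have "pcong 6 (l ^ Suc 3) (12960000 * x ^ 4 - 25920000 * x ^ 5)"
    proof (rule step[OF L3])
      show "l * (216000 * x ^ 3 - 324000 * x ^ 4 + 378000 * x ^ 5) - (12960000 * x ^ 4 - 25920000 * x ^ 5) = x ^ 6 *
        (36720000 - 21060000 * x + 15012000 * x ^ 2 - 9558000 * x ^ 3 + 4536000 * x ^ 4)"
        unfolding l_def by (simp add: algebra_simps eval_nat_numeral)
    qed (use px in simp_all)
    thus ?thesis by (simp add: power2_eq_square)
  qed
  have L5: "pcong 6 (l ^ 5) (777600000 * x ^ 5)"
  proof -
    have "pcong 6 (l ^ Suc 4) (777600000 * x ^ 5)"
    proof (rule step[OF L4])
      show "l * (12960000 * x ^ 4 - 25920000 * x ^ 5) - (777600000 * x ^ 5) = x ^ 6 *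
        (- (1944000000) + 1036800000 * x - 712800000 * x ^ 2 + 544320000 * x ^ 3 - 311040000 * x ^ 4)"
        unfolding l_def by (simp add: algebra_simps eval_nat_numeral)
    qed (use px in simp_all)
    thus ?thesis by (simp add: power2_eq_square)
  qed
  define c :: rat where "c = 120 * 60 ^ 5"
  have "pcong 6 (c + 120 * 60 ^ 4 * l + 60 * 60 ^ 3 * l\<^sup>2 + 20 * 60\<^sup>2 * l ^ 3 + 5 * 60 * l ^ 4 + l ^ 5)
     (c + 120 * 60 ^ 4 * (60 * x - 30 * x ^ 2 + 20 * x ^ 3 - 15 * x ^ 4 + 12 * x ^ 5) + 60 * 60 ^ 3 * (3600 * x ^ 2 - 3600 * x ^ 3 + 3300 * x ^ 4 - 3000 * x ^ 5) + 20 * 60\<^sup>2 * (216000 * x ^ 3 - 324000 * x ^ 4 + 378000 * x ^ 5)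
      + 5 * 60 * (12960000 * x ^ 4 - 25920000 * x ^ 5) + (777600000 * x ^ 5))"
    by (intro pcong_add pcong_lmult L1[unfolded power_one_right] L2 L3 L4 L5 pcong_refl) auto
  also have "\<dots> = c * (1 + x)" by (simp add: c_def algebra_simps)
  also have "c + 120 * 60 ^ 4 * l + 60 * 60 ^ 3 * l\<^sup>2 + 20 * 60\<^sup>2 * l ^ 3 + 5 * 60 * l ^ 4 + l ^ 5
      = c * trunc_exp (trunc_log x)"
    by (simp add: trunc_exp_def l c_def algebra_simps power_mult_distrib)
  finally have "pcong 6 (c * trunc_exp (trunc_log x)) (c * (1 + x))" .
  moreover have "pint (1 / c)"
  proof -
    have "pint ((1 / 120) * ((1 / 2) * (1 / 5) * (1 / 6)) ^ 5)"
      by (intro pint_mult pint_power pint_div_120 pint_div_small) auto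
    thus ?thesis by (simp add: c_def power_divide)
  qed
  ultimately have "pcong 6 (trunc_exp (trunc_log x)) (1 + x)"
    by (rule pcong_cancel_unit) (simp add: c_def)
  thus ?thesis by (simp add: X(2) x_def)
qed

end

section \<open>The logarithm of the factorial\<close>

context prime_at_least_7
begin

text \<open>The combination is the value at \<open>n = 0\<close> extrapolated from \<open>n = 1, ..., 5\<close>. It is exact for
  polynomials of degree at most four, and modulo \<open>p\<^sup>3\<close> the correction is one, with the value \<open>2/6\<close> times
  that of \<open>B\<^bsub>n,2\<^esub>\<close> at \<open>n = 0\<close>.\<close>

lemma corr2_extrapolation:
  "pcong 3 (5 * corr2 1 - 10 * corr2 2 + 10 * corr2 3 - 5 * corr2 4 + corr2 5) ((3 * Bd 1 2 - 3 * Bd 2 2 + Bd 3 2) / 3)"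
proof -
  obtain x u v where xuv: "pint x" "pint u" "pint v" and
    d: "pcong 3 (3 * Bd 1 2 - 3 * Bd 2 2 + Bd 3 2) x" and
    corr2: "\<And>n. n \<ge> 1 \<Longrightarrow> pcong 3 (corr2 n) ((of_nat n * (\<pi> - 1) - 1) * (of_nat n * (\<pi> - 1) - 2) / 6
        * (x + of_nat n * (\<pi> * u) + (of_nat n)\<^sup>2 * (\<pi>\<^sup>2 * v)))"
    using Bd2_expansion by metis
  define P where "P n = (of_nat n * (\<pi> - 1) - 1) * (of_nat n * (\<pi> - 1) - 2) / 6
        * (x + of_nat n * (\<pi> * u) + (of_nat n)\<^sup>2 * (\<pi>\<^sup>2 * v))" for n :: nat
  have "pcong 3 (5 * corr2 1 - 10 * corr2 2 + 10 * corr2 3 - 5 * corr2 4 + corr2 5) (5 * P 1 - 10 * P 2 + 10 * P 3 - 5 * P 4 + P 5)"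
    unfolding P_def by (intro pcong_add pcong_diff pcong_lmult corr2) auto
  also have "5 * P 1 - 10 * P 2 + 10 * P 3 - 5 * P 4 + P 5 = 1 / 3 * x"
    unfolding P_def by (simp add: field_simps power2_eq_square)
  also have "pcong 3 (1 / 3 * x) (1 / 3 * (3 * Bd 1 2 - 3 * Bd 2 2 + Bd 3 2))"
    using d by (intro pcong_lmult pint_div_small pcong_sym[OF d]) auto
  finally show ?thesis by simp
qed

text \<open>Modulo \<open>p\<close> the numbers \<open>B\<^bsub>n,4\<^esub>\<close> do not depend on \<open>n\<close>, and the quartic polynomial
  \<open>(m-1)(m-2)(m-3)(m-4)/120\<close> is extrapolated to its value \<open>24/120 = 1/5\<close> at \<open>m = 0\<close>.\<close>

lemma corr4_extrapolation:
  "pcong 1 (5 * corr4 1 - 10 * corr4 2 + 10 * corr4 3 - 5 * corr4 4 + corr4 5) (Bd 1 4 / 5)"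
proof -
  define R where "R n = (of_nat n * (\<pi> - 1) - 1) * (of_nat n * (\<pi> - 1) - 2) * (of_nat n * (\<pi> - 1) - 3)
       * (of_nat n * (\<pi> - 1) - 4) / 120 * Bd 1 4" for n :: nat
  have "pcong 1 (corr4 n) (R n)" if "n \<ge> 1" for n
    unfolding corr4_def R_def
    by (intro pcong_lmult Bd4_kummer that pint_div_120 pint_mult pint_diff) auto
  hence "pcong 1 (5 * corr4 1 - 10 * corr4 2 + 10 * corr4 3 - 5 * corr4 4 + corr4 5) (5 * R 1 - 10 * R 2 + 10 * R 3 - 5 * R 4 + R 5)"
    by (intro pcong_add pcong_diff pcong_lmult) auto
  also have "5 * R 1 - 10 * R 2 + 10 * R 3 - 5 * R 4 + R 5 = Bd 1 4 / 5"
    unfolding R_def by (simp add: field_simps)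
  finally show ?thesis .
qed

text \<open>The values of \<open>B\<^sub>n\<close> and \<open>B\<^bsub>n,2\<^esub>\<close> extrapolated to \<open>n = 0\<close>, from five and from three terms.\<close>

definition \<beta> :: rat where "\<beta> = 5 * B 1 - 10 * B 2 + 10 * B 3 - 5 * B 4 + B 5"
definition \<delta> :: rat where "\<delta> = 3 * Bd 1 2 - 3 * Bd 2 2 + Bd 3 2"

lemma neg_fact_cong_1: "pcong 1 (- fact (p - 1)) 1"
proof -
  have "[- fact (p - 1) = 1] (mod int p ^ 1)"
    using cong_minus_minus_iff[of "fact (p - 1)" "- 1" "int p"] wilson_theorem[OF p] by simp
  thus ?thesis by (simp only: flip: pcong_of_int) simp
qed

text \<open>The heart of the proof. The number \<open>((p-1)!)\<^bsup>p-1\<^esup>\<close> is both the product of \<open>p - 1\<close> copies of \<open>-(p-1)!\<close>,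
  which is \<open>1\<close> modulo \<open>p\<close> by Wilson's theorem, and the product of the \<open>a\<^bsup>p-1\<^esup>\<close>, which are \<open>1\<close> modulo \<open>p\<close> by
  Fermat's. Taking logarithms gives \<open>p - 1\<close> times the logarithm of \<open>-(p-1)!\<close> on one side, and a
  combination of the power sums, hence of divided Bernoulli numbers, on the other.\<close>

lemma log_neg_fact:
  "pcong 6 (trunc_log (- fact (p - 1) - 1)) (\<pi> * (\<beta> + \<pi>\<^sup>2 * (\<delta> / 3) + \<pi> ^ 4 * (Bd 1 4 / 5)))"
proof (rule pcong_cancel_p_minus_1)
  define P :: rat where "P = - fact (p - 1)"
  have "pcong 6 (trunc_log ((\<Prod>a\<in>{1..<p}. P) - 1)) (\<Sum>a\<in>{1..<p}. trunc_log (P - 1))"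
    using trunc_log_prod[of "{1..<p}" "\<lambda>_. P"] neg_fact_cong_1 by (auto simp: P_def)
  also have "(\<Sum>a\<in>{1..<p}. trunc_log (P - 1)) = (\<pi> - 1) * trunc_log (P - 1)"
    using p7 by (simp add: of_nat_diff)
  also have "(\<Prod>a\<in>{1..<p}. P) = (\<Prod>a\<in>{1..<p}. of_nat a ^ (p - 1))"
  proof -
    have "{1..<p} = {1..p - 1}" using p7 by auto
    hence "(\<Prod>a\<in>{1..<p}. of_nat a) = (fact (p - 1) :: rat)" by (simp add: fact_prod)
    hence "(\<Prod>a\<in>{1..<p}. of_nat a ^ (p - 1)) = (fact (p - 1) :: rat) ^ (p - 1)"
      by (simp only: prod_power_distrib[symmetric])
    also have "\<dots> = P ^ (p - 1)" using odd_p by (simp add: P_def)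
    finally show ?thesis by simp
  qed
  finally have 1: "pcong 6 ((\<pi> - 1) * trunc_log (P - 1)) (trunc_log ((\<Prod>a\<in>{1..<p}. of_nat a ^ (p - 1)) - 1))"
    by (rule pcong_sym)
  have "pcong 1 (of_nat a ^ (p - 1)) 1" if "a \<in> {1..<p}" for a
    using pint_fermat_quotient[OF that] by (simp add: pcong_def)
  hence "pcong 6 (trunc_log ((\<Prod>a\<in>{1..<p}. of_nat a ^ (p - 1)) - 1)) (\<Sum>a\<in>{1..<p}. trunc_log (of_nat a ^ (p - 1) - 1))"
    using trunc_log_prod[of "{1..<p}" "\<lambda>a. of_nat a ^ (p - 1)"] by auto
  also have "(\<Sum>a\<in>{1..<p}. trunc_log (of_nat a ^ (p - 1) - 1)) =
      (\<Sum>a\<in>{1..<p}. 5 * (of_nat a ^ (1 * (p - 1)) - 1) - 5 * (of_nat a ^ (2 * (p - 1)) - 1)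
       + 10 / 3 * (of_nat a ^ (3 * (p - 1)) - 1) - 5 / 4 * (of_nat a ^ (4 * (p - 1)) - 1)
       + 1 / 5 * (of_nat a ^ (5 * (p - 1)) - 1))"
    unfolding trunc_log_powers by (simp only: power_mult[symmetric] mult_1 mult.commute[of "p - 1"])
  also have "\<dots> = 5 * pow_excess 1 - 5 * pow_excess 2 + 10 / 3 * pow_excess 3 - 5 / 4 * pow_excess 4 + 1 / 5 * pow_excess 5"
    by (simp only: pow_excess_def sum.distrib sum_subtractf sum_distrib_left[symmetric])
  also have "pcong 6 \<dots> (5 * (\<pi> * (of_nat 1 * (\<pi> - 1)) * (B 1 + \<pi>\<^sup>2 * corr2 1 + \<pi> ^ 4 * corr4 1))
     - 5 * (\<pi> * (of_nat 2 * (\<pi> - 1)) * (B 2 + \<pi>\<^sup>2 * corr2 2 + \<pi> ^ 4 * corr4 2))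
     + 10 / 3 * (\<pi> * (of_nat 3 * (\<pi> - 1)) * (B 3 + \<pi>\<^sup>2 * corr2 3 + \<pi> ^ 4 * corr4 3))
     - 5 / 4 * (\<pi> * (of_nat 4 * (\<pi> - 1)) * (B 4 + \<pi>\<^sup>2 * corr2 4 + \<pi> ^ 4 * corr4 4))
     + 1 / 5 * (\<pi> * (of_nat 5 * (\<pi> - 1)) * (B 5 + \<pi>\<^sup>2 * corr2 5 + \<pi> ^ 4 * corr4 5)))"
    by (intro pcong_add pcong_diff pcong_lmult pow_excess_expansion pint_div_small) auto
  also have "\<dots> = (\<pi> - 1) * (\<pi> * (\<beta> + \<pi>\<^sup>2 * (5 * corr2 1 - 10 * corr2 2 + 10 * corr2 3 - 5 * corr2 4 + corr2 5)
     + \<pi> ^ 4 * (5 * corr4 1 - 10 * corr4 2 + 10 * corr4 3 - 5 * corr4 4 + corr4 5)))"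
    by (simp add: \<beta>_def algebra_simps)
  also have "pcong 6 \<dots> ((\<pi> - 1) * (\<pi> * (\<beta> + \<pi>\<^sup>2 * (\<delta> / 3) + \<pi> ^ 4 * (Bd 1 4 / 5))))"
  proof (rule pcong_lmult)
    have a: "pcong 5 (\<pi>\<^sup>2 * (5 * corr2 1 - 10 * corr2 2 + 10 * corr2 3 - 5 * corr2 4 + corr2 5)) (\<pi>\<^sup>2 * (\<delta> / 3))"
      using corr2_extrapolation pcong_scale[of 3 _ _ 2] by (simp add: \<delta>_def)
    have c: "pcong 5 (\<pi> ^ 4 * (5 * corr4 1 - 10 * corr4 2 + 10 * corr4 3 - 5 * corr4 4 + corr4 5)) (\<pi> ^ 4 * (Bd 1 4 / 5))"
      using corr4_extrapolation pcong_scale[of 1 _ _ 4] by simp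
    have "pcong 5 (\<beta> + \<pi>\<^sup>2 * (5 * corr2 1 - 10 * corr2 2 + 10 * corr2 3 - 5 * corr2 4 + corr2 5)
        + \<pi> ^ 4 * (5 * corr4 1 - 10 * corr4 2 + 10 * corr4 3 - 5 * corr4 4 + corr4 5))
      (\<beta> + \<pi>\<^sup>2 * (\<delta> / 3) + \<pi> ^ 4 * (Bd 1 4 / 5))"
      by (intro pcong_add a c pcong_refl)
    thus "pcong 6 (\<pi> * (\<beta> + \<pi>\<^sup>2 * (5 * corr2 1 - 10 * corr2 2 + 10 * corr2 3 - 5 * corr2 4 + corr2 5)
        + \<pi> ^ 4 * (5 * corr4 1 - 10 * corr4 2 + 10 * corr4 3 - 5 * corr4 4 + corr4 5)))
      (\<pi> * (\<beta> + \<pi>\<^sup>2 * (\<delta> / 3) + \<pi> ^ 4 * (Bd 1 4 / 5)))"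
      using pcong_scale[of 5 _ _ 1] by simp
  qed simp
  finally show "pcong 6 ((\<pi> - 1) * trunc_log (- fact (p - 1) - 1))
     ((\<pi> - 1) * (\<pi> * (\<beta> + \<pi>\<^sup>2 * (\<delta> / 3) + \<pi> ^ 4 * (Bd 1 4 / 5))))"
    using 1 unfolding P_def by (blast intro: pcong_trans)
qed

lemma divided_bernoulli_newton:
  obtains b0 b1 b2 b3 b4 where "pint b0" "pint b1" "pint b2" "pint b3" "pint b4"
    "B 1 = b0" "B 2 = b0 + \<pi> * b1" "B 3 = b0 + 2 * \<pi> * b1 + \<pi>\<^sup>2 * b2"
    "B 4 = b0 + 3 * \<pi> * b1 + 3 * \<pi>\<^sup>2 * b2 + \<pi> ^ 3 * b3"
    "B 5 = b0 + 4 * \<pi> * b1 + 6 * \<pi>\<^sup>2 * b2 + 4 * \<pi> ^ 3 * b3 + \<pi> ^ 4 * b4"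
proof -
  obtain b1 b2 b3 b4 where b: "pint b1" "pint b2" "pint b3" "pint b4" and
    "B 2 - B 1 = \<pi> * b1" "B 3 - 2 * B 2 + B 1 = \<pi>\<^sup>2 * b2"
    "B 4 - 3 * B 3 + 3 * B 2 - B 1 = \<pi> ^ 3 * b3"
    "B 5 - 4 * B 4 + 6 * B 3 - 4 * B 2 + B 1 = \<pi> ^ 4 * b4"
    using divided_bernoulli_kummer(2-5) by (auto elim!: pcongE)
  hence "B 2 = B 1 + \<pi> * b1" "B 3 = B 1 + 2 * \<pi> * b1 + \<pi>\<^sup>2 * b2"
    "B 4 = B 1 + 3 * \<pi> * b1 + 3 * \<pi>\<^sup>2 * b2 + \<pi> ^ 3 * b3"
    "B 5 = B 1 + 4 * \<pi> * b1 + 6 * \<pi>\<^sup>2 * b2 + 4 * \<pi> ^ 3 * b3 + \<pi> ^ 4 * b4"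
    by linarith+
  with b divided_bernoulli_kummer(1) show ?thesis by (intro that) auto
qed

lemma pint_B: "n \<in> {1..5} \<Longrightarrow> pint (B n)"
proof -
  assume "n \<in> {1..5}"
  hence n: "n = 1 \<or> n = 2 \<or> n = 3 \<or> n = 4 \<or> n = 5" by auto
  show "pint (B n)"
  proof (rule divided_bernoulli_newton)
    fix b0 b1 b2 b3 b4
    assume *: "pint b0" "pint b1" "pint b2" "pint b3" "pint b4"
      "B 1 = b0" "B 2 = b0 + \<pi> * b1" "B 3 = b0 + 2 * \<pi> * b1 + \<pi>\<^sup>2 * b2"
      "B 4 = b0 + 3 * \<pi> * b1 + 3 * \<pi>\<^sup>2 * b2 + \<pi> ^ 3 * b3"
      "B 5 = b0 + 4 * \<pi> * b1 + 6 * \<pi>\<^sup>2 * b2 + 4 * \<pi> ^ 3 * b3 + \<pi> ^ 4 * b4"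
    show "pint (B n)"
      using n by (elim disjE) (simp_all only: *, simp_all add: *)
  qed
qed

lemma pint_beta: "pint \<beta>" and pint_delta: "pint \<delta>" and pint_Bd14: "pint (Bd 1 4)"
  unfolding \<beta>_def \<delta>_def by (intro pint_add pint_diff pint_mult pint_B pint_Bd; simp)+

text \<open>The exponential of the preceding congruence, sorted by the explicit powers of \<open>p\<close>.\<close>

lemma neg_fact_expansion:
  "pcong 6 (- fact (p - 1)) (1 + \<pi> * \<beta> + \<pi>\<^sup>2 * (\<beta>\<^sup>2 / 2) + \<pi> ^ 3 * (\<beta> ^ 3 / 6 + \<delta> / 3)
    + \<pi> ^ 4 * (\<beta> ^ 4 / 24 + \<beta> * \<delta> / 3) + \<pi> ^ 5 * (\<beta> ^ 5 / 120 + \<beta>\<^sup>2 * \<delta> / 6 + Bd 1 4 / 5))"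
proof -
  define d where "d = \<delta> / 3"
  define g where "g = Bd 1 4 / 5"
  define z where "z = \<beta> + \<pi>\<^sup>2 * d + \<pi> ^ 4 * g"
  have pd: "pint d" and pg: "pint g"
    unfolding d_def g_def by (intro pint_div_small pint_delta pint_Bd14; simp)+
  have pz: "pint z" unfolding z_def using pd pg pint_beta by simp
  note pints = pd pg pint_beta
  have z2: "pcong 4 (z\<^sup>2) (\<beta>\<^sup>2 + 2 * \<pi>\<^sup>2 * \<beta> * d)"
    by (rule pcongI[where c = "d\<^sup>2 + 2 * \<beta> * g + 2 * \<pi>\<^sup>2 * d * g + \<pi> ^ 4 * g\<^sup>2"])
       (use pints in \<open>simp_all add: z_def algebra_simps eval_nat_numeral\<close>)
  have z3: "pcong 3 (z ^ 3) (\<beta> ^ 3 + 3 * \<pi>\<^sup>2 * \<beta>\<^sup>2 * d)"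
  proof -
    have "pcong 3 (z * z\<^sup>2) (z * (\<beta>\<^sup>2 + 2 * \<pi>\<^sup>2 * \<beta> * d))"
      using z2 pz by (intro pcong_lmult pcong_weaken[OF z2]) auto
    also have "pcong 3 \<dots> (\<beta> ^ 3 + 3 * \<pi>\<^sup>2 * \<beta>\<^sup>2 * d)"
      by (rule pcongI[where c = "\<pi> * (2 * \<beta> * d\<^sup>2 + \<beta>\<^sup>2 * g + 2 * \<pi>\<^sup>2 * \<beta> * d * g)"])
         (use pints in \<open>simp_all add: z_def algebra_simps eval_nat_numeral\<close>)
    finally show ?thesis by (simp add: eval_nat_numeral)
  qed
  have z1: "pcong 2 z \<beta>"
    by (rule pcongI[where c = "d + \<pi>\<^sup>2 * g"]) (use pints in \<open>simp_all add: z_def algebra_simps eval_nat_numeral\<close>)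
  have z4: "pcong 2 (z ^ 4) (\<beta> ^ 4)" by (rule pcong_power[OF z1 pint_beta])
  have z5: "pcong 1 (z ^ 5) (\<beta> ^ 5)"
    by (rule pcong_power[OF pcong_weaken[OF z1] pint_beta]) simp
  have half: "pint (1 / 2)" and sixth: "pint (1 / 6)" and c120: "pint (1 / 120)"
    by (intro pint_div_small pint_div_120; simp)+
  have "pint (1 / 4 / 6)" by (intro pint_div_small) auto
  hence c24: "pint (1 / 24)" by simp
  have t2: "pcong 6 (\<pi>\<^sup>2 * (1 / 2 * z\<^sup>2)) (\<pi>\<^sup>2 * (1 / 2 * (\<beta>\<^sup>2 + 2 * \<pi>\<^sup>2 * \<beta> * d)))"
    using pcong_scale[of 4 _ _ 2] pcong_lmult[OF half z2] by simp
  have t3: "pcong 6 (\<pi> ^ 3 * (1 / 6 * z ^ 3)) (\<pi> ^ 3 * (1 / 6 * (\<beta> ^ 3 + 3 * \<pi>\<^sup>2 * \<beta>\<^sup>2 * d)))"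
    using pcong_scale[of 3 _ _ 3] pcong_lmult[OF sixth z3] by simp
  have t4: "pcong 6 (\<pi> ^ 4 * (1 / 24 * z ^ 4)) (\<pi> ^ 4 * (1 / 24 * \<beta> ^ 4))"
    using pcong_scale[of 2 _ _ 4] pcong_lmult[OF c24 z4] by simp
  have t5: "pcong 6 (\<pi> ^ 5 * (1 / 120 * z ^ 5)) (\<pi> ^ 5 * (1 / 120 * \<beta> ^ 5))"
    using pcong_scale[of 1 _ _ 5] pcong_lmult[OF c120 z5] by simp
  have "pcong 6 (- fact (p - 1)) (trunc_exp (trunc_log (- fact (p - 1) - 1)))"
    by (rule pcong_sym[OF trunc_exp_log[OF neg_fact_cong_1]])
  also have "pcong 6 \<dots> (trunc_exp (\<pi> * z))"
    using log_neg_fact pz unfolding z_def d_def g_def by (intro trunc_exp_cong) auto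
  also have "trunc_exp (\<pi> * z) = 1 + \<pi> * z + \<pi>\<^sup>2 * (1 / 2 * z\<^sup>2) + \<pi> ^ 3 * (1 / 6 * z ^ 3)
      + \<pi> ^ 4 * (1 / 24 * z ^ 4) + \<pi> ^ 5 * (1 / 120 * z ^ 5)"
    by (simp add: trunc_exp_def power_mult_distrib)
  also have "pcong 6 \<dots> (1 + \<pi> * z + \<pi>\<^sup>2 * (1 / 2 * (\<beta>\<^sup>2 + 2 * \<pi>\<^sup>2 * \<beta> * d))
      + \<pi> ^ 3 * (1 / 6 * (\<beta> ^ 3 + 3 * \<pi>\<^sup>2 * \<beta>\<^sup>2 * d)) + \<pi> ^ 4 * (1 / 24 * \<beta> ^ 4) + \<pi> ^ 5 * (1 / 120 * \<beta> ^ 5))"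
    by (intro pcong_add t2 t3 t4 t5 pcong_refl)
  also have "\<dots> = 1 + \<pi> * \<beta> + \<pi>\<^sup>2 * (\<beta>\<^sup>2 / 2) + \<pi> ^ 3 * (\<beta> ^ 3 / 6 + d)
    + \<pi> ^ 4 * (\<beta> ^ 4 / 24 + \<beta> * d) + \<pi> ^ 5 * (\<beta> ^ 5 / 120 + \<beta>\<^sup>2 * d / 2 + g)"
    unfolding z_def by (simp add: algebra_simps eval_nat_numeral)
  finally show ?thesis by (simp add: d_def g_def)
qed

text \<open>By Kummer's congruences both sides become polynomials in \<open>p\<close>, the divided differences of the \<open>B\<^sub>n\<close>
  and the coefficients of the quadratic sequence \<open>B\<^bsub>n,2\<^esub>\<close>. They agree in their terms of low degree in \<open>p\<close>; the
  remainders are given explicitly.\<close>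

lemma coefficient_congruences:
  shows "- 5 * B 1 + 10 * B 2 - 10 * B 3 + 5 * B 4 - B 5 = - \<beta>"
    and "pcong 4 (- (5/2) * (B 1)^2 + 15/2 * (B 2)^2 + 5/2 * (B 3)^2 + B 1 * B 4 - 9 * B 2 * B 3) (- (\<beta>\<^sup>2 / 2))"
    and "pcong 3 (- (1/2) * B 1 * (B 2)^2 - (B 1)^2 * (5/3 * B 1 - 5/2 * B 2 + 1/2 * B 3)
           - Bd 1 2 + Bd 2 2 - 1/3 * Bd 3 2) (- (\<beta> ^ 3 / 6 + \<delta> / 3))"
    and "pcong 2 (- (5/24) * (B 1)^4 + 1/6 * (B 1)^3 * B 2 - 2/3 * B 1 * Bd 1 2 + 1/3 * B 2 * Bd 2 2)
          (- (\<beta> ^ 4 / 24 + \<beta> * \<delta> / 3))"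
    and "pcong 1 (- (1/120) * (B 1)^5 - 1/6 * (B 1)^2 * Bd 1 2 - 1/5 * Bd 1 4)
          (- (\<beta> ^ 5 / 120 + \<beta>\<^sup>2 * \<delta> / 6 + Bd 1 4 / 5))"
proof -
  show "- 5 * B 1 + 10 * B 2 - 10 * B 3 + 5 * B 4 - B 5 = - \<beta>" by (simp add: \<beta>_def)
  obtain b0 b1 b2 b3 b4 where b: "pint b0" "pint b1" "pint b2" "pint b3" "pint b4" and
    B: "B 1 = b0" "B 2 = b0 + \<pi> * b1" "B 3 = b0 + 2 * \<pi> * b1 + \<pi>\<^sup>2 * b2"
      "B 4 = b0 + 3 * \<pi> * b1 + 3 * \<pi>\<^sup>2 * b2 + \<pi> ^ 3 * b3"
      "B 5 = b0 + 4 * \<pi> * b1 + 6 * \<pi>\<^sup>2 * b2 + 4 * \<pi> ^ 3 * b3 + \<pi> ^ 4 * b4"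
    by (rule divided_bernoulli_newton)
  have \<beta>: "\<beta> = b0 - \<pi> * b1 + \<pi>\<^sup>2 * b2 - \<pi> ^ 3 * b3 + \<pi> ^ 4 * b4"
    unfolding \<beta>_def B by (simp add: algebra_simps)
  obtain x u v where x: "pint x" "pint u" "pint v" and
    Bd: "\<And>n. n \<ge> 1 \<Longrightarrow> pcong 3 (Bd n 2) (x + of_nat n * (\<pi> * u) + (of_nat n)\<^sup>2 * (\<pi>\<^sup>2 * v))" and
    \<delta>: "pcong 3 \<delta> x"
    using Bd2_expansion unfolding \<delta>_def by metis
  have c: "pint (1 / 2)" "pint (1 / 3)" "pint (1 / 6)" "pint (1 / 120)"
    by (intro pint_div_small pint_div_120; simp)+
  have c24: "pint (a / 24)" if "pint a" for a
  proof -
    have "pint (a / 4 / 6)" using that by (intro pint_div_small) auto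
    thus ?thesis by simp
  qed
  have half: "pint (a / 2)" if "pint a" for a using that by (intro pint_div_small) auto
  have third: "pint (a / 3)" if "pint a" for a using that by (intro pint_div_small) auto
  have sixth: "pint (a / 6)" if "pint a" for a using that by (intro pint_div_small) auto

  define t4 where "t4 = b0 - \<pi> * b1 + \<pi>\<^sup>2 * b2 - \<pi> ^ 3 * b3"
  have t4: "pcong 4 \<beta> t4" unfolding \<beta> t4_def by (rule pcongI[where c = b4]) (use b in simp_all)
  have pt4: "pint t4" using b by (simp add: t4_def)
  have "pcong 4 (- (5/2) * (B 1)^2 + 15/2 * (B 2)^2 + 5/2 * (B 3)^2 + B 1 * B 4 - 9 * B 2 * B 3) (- (1 / 2 * t4\<^sup>2))"
  proof (rule pcongI)
    show "- (5/2) * (B 1)^2 + 15/2 * (B 2)^2 + 5/2 * (B 3)^2 + B 1 * B 4 - 9 * B 2 * B 3 - - (1 / 2 * t4\<^sup>2)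
        = \<pi> ^ 4 * (b1 * b3 - b2 * b3 * \<pi> + 3 * b2 ^ 2 + b3 ^ 2 * \<pi> ^ 2 / 2)"
      unfolding B t4_def by (simp add: algebra_simps eval_nat_numeral add_divide_distrib diff_divide_distrib)
  qed (use b half in auto)
  also have "pcong 4 (- (1 / 2 * t4\<^sup>2)) (- (1 / 2 * \<beta>\<^sup>2))"
    by (intro pcong_minus pcong_lmult c pcong_power pcong_sym[OF t4] pint_beta)
  finally show "pcong 4 (- (5/2) * (B 1)^2 + 15/2 * (B 2)^2 + 5/2 * (B 3)^2 + B 1 * B 4 - 9 * B 2 * B 3) (- (\<beta>\<^sup>2 / 2))"
    by simp

  define t3 where "t3 = b0 - \<pi> * b1 + \<pi>\<^sup>2 * b2"
  have t3: "pcong 3 \<beta> t3" unfolding \<beta> t3_def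
    by (rule pcongI[where c = "- b3 + \<pi> * b4"]) (use b in \<open>simp_all add: algebra_simps eval_nat_numeral\<close>)
  have "pcong 3 (- (1/2) * B 1 * (B 2)^2 - (B 1)^2 * (5/3 * B 1 - 5/2 * B 2 + 1/2 * B 3)) (- (1 / 6 * t3 ^ 3))"
  proof (rule pcongI)
    show "- (1/2) * B 1 * (B 2)^2 - (B 1)^2 * (5/3 * B 1 - 5/2 * B 2 + 1/2 * B 3) - - (1 / 6 * t3 ^ 3)
        = \<pi> ^ 3 * (b0 * b2 ^ 2 * \<pi> / 2 - b0 * b1 * b2 - b1 * b2 ^ 2 * \<pi> ^ 2 / 2 + b1 ^ 2 * b2 * \<pi> / 2
          - b1 ^ 3 / 6 + b2 ^ 3 * \<pi> ^ 3 / 6)"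
      unfolding B t3_def by (simp add: algebra_simps eval_nat_numeral add_divide_distrib diff_divide_distrib)
  qed (use b half sixth in auto)
  also have "pcong 3 (- (1 / 6 * t3 ^ 3)) (- (1 / 6 * \<beta> ^ 3))"
    by (intro pcong_minus pcong_lmult c pcong_power pcong_sym[OF t3] pint_beta)
  finally have "pcong 3 (- (1/2) * B 1 * (B 2)^2 - (B 1)^2 * (5/3 * B 1 - 5/2 * B 2 + 1/2 * B 3) - \<delta> / 3)
     (- (1 / 6 * \<beta> ^ 3) - \<delta> / 3)"
    by (intro pcong_diff pcong_refl)
  thus "pcong 3 (- (1/2) * B 1 * (B 2)^2 - (B 1)^2 * (5/3 * B 1 - 5/2 * B 2 + 1/2 * B 3)
           - Bd 1 2 + Bd 2 2 - 1/3 * Bd 3 2) (- (\<beta> ^ 3 / 6 + \<delta> / 3))"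
    by (simp add: \<delta>_def add_divide_distrib diff_divide_distrib algebra_simps)

  define t2 where "t2 = b0 - \<pi> * b1"
  have t2: "pcong 2 \<beta> t2" unfolding \<beta> t2_def
    by (rule pcongI[where c = "b2 - \<pi> * b3 + \<pi>\<^sup>2 * b4"]) (use b in \<open>simp_all add: algebra_simps eval_nat_numeral\<close>)
  have pt2: "pint t2" using b by (simp add: t2_def)
  have Bd2: "pcong 2 (Bd n 2) (x + of_nat n * (\<pi> * u))" if "n \<ge> 1" for n
  proof -
    have "pcong 2 (x + of_nat n * (\<pi> * u) + (of_nat n)\<^sup>2 * (\<pi>\<^sup>2 * v)) (x + of_nat n * (\<pi> * u))"
      by (rule pcongI[where c = "(of_nat n)\<^sup>2 * v"]) (use x in simp_all)
    with pcong_weaken[OF Bd[OF that], of 2] show ?thesis by (auto intro: pcong_trans)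
  qed
  have pB: "pint (B 1)" "pint (B 2)" by (intro pint_B; simp)+
  have "pcong 2 (- (5/24) * (B 1)^4 + 1/6 * (B 1)^3 * B 2 - 2 * (1/3) * B 1 * Bd 1 2 + 1/3 * B 2 * Bd 2 2)
     (- (5/24) * (B 1)^4 + 1/6 * (B 1)^3 * B 2 - 2 * (1/3) * B 1 * (x + of_nat 1 * (\<pi> * u))
       + 1/3 * B 2 * (x + of_nat 2 * (\<pi> * u)))"
    using pB c by (intro pcong_add pcong_diff pcong_refl pcong_lmult Bd2) (auto intro!: third)
  also have "pcong 2 \<dots> (- (1 / 24 * t2 ^ 4 + 1 / 3 * (t2 * x)))"
  proof (rule pcongI)
    show "- (5/24) * (B 1)^4 + 1/6 * (B 1)^3 * B 2 - 2 * (1/3) * B 1 * (x + of_nat 1 * (\<pi> * u))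
       + 1/3 * B 2 * (x + of_nat 2 * (\<pi> * u)) - - (1 / 24 * t2 ^ 4 + 1 / 3 * (t2 * x))
      = \<pi>\<^sup>2 * (b0 ^ 2 * b1 ^ 2 / 4 - b0 * b1 ^ 3 * \<pi> / 6 + b1 ^ 4 * \<pi> ^ 2 / 24 + 2 * (b1 * u / 3))"
      unfolding B t2_def by (simp add: algebra_simps eval_nat_numeral add_divide_distrib diff_divide_distrib)
    have "pint (b0 ^ 2 * b1 ^ 2 / 4)" using b by (intro pint_div_small) auto
    thus "pint (b0 ^ 2 * b1 ^ 2 / 4 - b0 * b1 ^ 3 * \<pi> / 6 + b1 ^ 4 * \<pi> ^ 2 / 24 + 2 * (b1 * u / 3))"
      using b x third sixth c24 by auto
  qed
  also have "pcong 2 (- (1 / 24 * t2 ^ 4 + 1 / 3 * (t2 * x))) (- (1 / 24 * \<beta> ^ 4 + 1 / 3 * (\<beta> * \<delta>)))"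
    using c24[of 1] by (intro pcong_minus pcong_add pcong_lmult c pcong_power pcong_mult pcong_sym[OF t2] pint_beta
      pcong_sym[OF pcong_weaken[OF \<delta>]] pint_delta) auto
  finally show "pcong 2 (- (5/24) * (B 1)^4 + 1/6 * (B 1)^3 * B 2 - 2/3 * B 1 * Bd 1 2 + 1/3 * B 2 * Bd 2 2)
          (- (\<beta> ^ 4 / 24 + \<beta> * \<delta> / 3))"
    by simp

  have B1: "pcong 1 (B 1) \<beta>"
    unfolding B(1) \<beta>
    by (rule pcongI[where c = "b1 - \<pi> * b2 + \<pi>\<^sup>2 * b3 - \<pi> ^ 3 * b4"]) (use b in \<open>simp_all add: algebra_simps eval_nat_numeral\<close>)
  have "pcong 1 (Bd 1 2) x"
    by (rule pcong_trans[OF pcong_weaken[OF Bd2[of 1]]], simp, simp, rule pcongI[where c = u]) (use x in simp_all)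
  hence d1: "pcong 1 (Bd 1 2) \<delta>"
    using pcong_sym[OF pcong_weaken[OF \<delta>]] by (auto intro: pcong_trans)
  have "pcong 1 (- (1/120 * (B 1)^5 + 1/6 * ((B 1)^2 * Bd 1 2) + Bd 1 4 / 5)) (- (1 / 120 * \<beta> ^ 5 + 1 / 6 * (\<beta>\<^sup>2 * \<delta>) + Bd 1 4 / 5))"
    by (intro pcong_minus pcong_add pcong_lmult pcong_mult pcong_power B1 d1 c pint_beta pint_delta pint_power pcong_refl)
  thus "pcong 1 (- (1/120) * (B 1)^5 - 1/6 * (B 1)^2 * Bd 1 2 - 1/5 * Bd 1 4)
          (- (\<beta> ^ 5 / 120 + \<beta>\<^sup>2 * \<delta> / 6 + Bd 1 4 / 5))"
    by simp
qed

lemma pint_coefficients: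
  "pint (- (\<beta>\<^sup>2 / 2))" "pint (- (\<beta> ^ 3 / 6 + \<delta> / 3))" "pint (- (\<beta> ^ 4 / 24 + \<beta> * \<delta> / 3))"
  "pint (- (\<beta> ^ 5 / 120 + \<beta>\<^sup>2 * \<delta> / 6 + Bd 1 4 / 5))"
proof -
  have "pint (\<beta> ^ 4 / 4 / 6)" by (intro pint_div_small pint_power pint_beta) auto
  hence 24: "pint (\<beta> ^ 4 / 24)" by simp
  have "pint (\<beta> * \<delta> / 3)" by (intro pint_div_small pint_mult pint_beta pint_delta) auto
  thus "pint (- (\<beta> ^ 4 / 24 + \<beta> * \<delta> / 3))" by (intro pint_minus pint_add 24)
  show "pint (- (\<beta>\<^sup>2 / 2))" "pint (- (\<beta> ^ 3 / 6 + \<delta> / 3))"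
    "pint (- (\<beta> ^ 5 / 120 + \<beta>\<^sup>2 * \<delta> / 6 + Bd 1 4 / 5))"
    by (intro pint_minus pint_add pint_div_small pint_div_120 pint_power pint_mult pint_beta pint_delta pint_Bd14; simp)+
qed

end

section \<open>Congruences in the ring of p-adic integers\<close>

context fixed_prime
begin

abbreviation Zp :: "(nat \<Rightarrow> int) ring" where "Zp \<equiv> padic_int p"

lemma cring_Zp: "cring Zp"
  by (rule padic_int_cring) (use p prime_gt_0_nat in blast)

lemma Zp_bounds: "x \<in> carrier Zp \<Longrightarrow> 0 \<le> x k \<and> x k < int p ^ k"
  by (simp add: padic_int_def)

lemma Zp_coherent:
  assumes "x \<in> carrier Zp" shows "x (k + j) mod int p ^ k = x k"
proof (induction j)
  case 0
  show ?case using Zp_bounds[OF assms, of k] by simp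
next
  case (Suc j)
  have "x (k + Suc j) mod int p ^ (k + j) = x (k + j)"
    using assms by (simp add: padic_int_def)
  hence "x (k + j) mod int p ^ k = x (k + Suc j) mod int p ^ (k + j) mod int p ^ k" by simp
  also have "\<dots> = x (k + Suc j) mod int p ^ k"
    by (rule mod_mod_cancel) (simp add: le_imp_power_dvd)
  finally show ?case using Suc by simp
qed

lemma Zp_minus_eval:
  assumes "a \<in> carrier Zp" "b \<in> carrier Zp"
  shows "(a \<ominus>\<^bsub>Zp\<^esub> b) k = (a k - b k) mod int p ^ k" and "(\<ominus>\<^bsub>Zp\<^esub> b) k = (- b k) mod int p ^ k"
proof -
  interpret R: cring Zp by (rule cring_Zp)
  have "(\<ominus>\<^bsub>Zp\<^esub> b) \<oplus>\<^bsub>Zp\<^esub> b = \<zero>\<^bsub>Zp\<^esub>" using assms by (simp add: R.l_neg)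
  hence "((\<ominus>\<^bsub>Zp\<^esub> b) k + b k) mod int p ^ k = 0"
    by (simp add: padic_int_def fun_eq_iff)
  hence "[(\<ominus>\<^bsub>Zp\<^esub> b) k = - b k] (mod int p ^ k)"
    by (simp add: cong_iff_dvd_diff dvd_eq_mod_eq_0)
  moreover have "(\<ominus>\<^bsub>Zp\<^esub> b) k mod int p ^ k = (\<ominus>\<^bsub>Zp\<^esub> b) k"
    using Zp_bounds[of "\<ominus>\<^bsub>Zp\<^esub> b" k] assms by simp
  ultimately show neg: "(\<ominus>\<^bsub>Zp\<^esub> b) k = (- b k) mod int p ^ k" by (simp add: cong_def)
  have "(a \<ominus>\<^bsub>Zp\<^esub> b) k = (a k + (\<ominus>\<^bsub>Zp\<^esub> b) k) mod int p ^ k"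
    by (simp add: a_minus_def) (simp add: padic_int_def)
  thus "(a \<ominus>\<^bsub>Zp\<^esub> b) k = (a k - b k) mod int p ^ k"
    unfolding neg by (simp add: mod_simps)
qed

lemma padic_of_rat_p_power: "padic_of_rat p (\<pi> ^ k) j = int p ^ k mod int p ^ j"
  using padic_of_rat_of_int[of p "int p ^ k" j] by simp

text \<open>A \<open>p\<close>-adic integer whose residue modulo \<open>p ^ k\<close> vanishes is divisible by \<open>p ^ k\<close>: its residues
  at the levels \<open>j + k\<close>, divided by \<open>p ^ k\<close>, form the quotient.\<close>

lemma Zp_divisible:
  assumes z: "z \<in> carrier Zp" and "z k = 0"
  shows "\<exists>y\<in>carrier Zp. z = y \<otimes>\<^bsub>Zp\<^esub> padic_of_rat p (\<pi> ^ k)"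
proof
  define y where "y = (\<lambda>j. z (j + k) div int p ^ k)"
  have P: "int p ^ j > 0" for j using p prime_gt_0_nat by simp
  have y: "z (j + k) = int p ^ k * y j" for j
    using Zp_coherent[OF z, of k j] assms(2) unfolding y_def
    by (simp add: add.commute mod_0_imp_dvd)
  have "y (Suc j) mod int p ^ j = y j" for j
  proof -
    have "z (Suc j + k) mod int p ^ (j + k) = z (j + k)"
      using Zp_coherent[OF z, of "j + k" 1] by simp
    hence "(int p ^ k * y (Suc j)) mod (int p ^ k * int p ^ j) = int p ^ k * y j"
      unfolding y power_add by (simp only: mult.commute[of "int p ^ j"])
    hence "int p ^ k * (y (Suc j) mod int p ^ j) = int p ^ k * y j"
      by (simp only: mult_mod_right)
    thus ?thesis using P[of k] by simp
  qed
  moreover have "0 \<le> y j \<and> y j < int p ^ j" for j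
    using Zp_bounds[OF z, of "j + k"] P[of k]
    by (simp add: y power_add zero_le_mult_iff mult.commute)
  ultimately show "y \<in> carrier Zp" by (simp add: padic_int_def)
  show "z = y \<otimes>\<^bsub>Zp\<^esub> padic_of_rat p (\<pi> ^ k)"
  proof
    fix j
    have "z j = z (j + k) mod int p ^ j" using Zp_coherent[OF z] by simp
    also have "\<dots> = (y j * (int p ^ k mod int p ^ j)) mod int p ^ j"
      by (simp add: y mod_simps mult.commute)
    also have "\<dots> = (y \<otimes>\<^bsub>Zp\<^esub> padic_of_rat p (\<pi> ^ k)) j"
      by (simp add: padic_int_def padic_of_rat_p_power)
    finally show "z j = (y \<otimes>\<^bsub>Zp\<^esub> padic_of_rat p (\<pi> ^ k)) j" .
  qed
qed

lemma padic_cong_iff: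
  assumes a: "a \<in> carrier Zp" and b: "b \<in> carrier Zp"
  shows "padic_cong p k a b \<longleftrightarrow> a k = b k"
proof -
  interpret R: cring Zp by (rule cring_Zp)
  have z: "a \<ominus>\<^bsub>Zp\<^esub> b \<in> carrier Zp" using a b by simp
  have eq: "(a \<ominus>\<^bsub>Zp\<^esub> b) k = 0 \<longleftrightarrow> a k = b k"
  proof -
    have "(a k - b k) mod int p ^ k = 0 \<longleftrightarrow> a k mod int p ^ k = b k mod int p ^ k"
      by (simp add: mod_eq_dvd_iff dvd_eq_mod_eq_0)
    thus ?thesis using Zp_bounds[OF a, of k] Zp_bounds[OF b, of k] Zp_minus_eval[OF a b, of k] by simp
  qed
  have "padic_cong p k a b \<longleftrightarrow> (\<exists>y\<in>carrier Zp. a \<ominus>\<^bsub>Zp\<^esub> b = y \<otimes>\<^bsub>Zp\<^esub> padic_of_rat p (\<pi> ^ k))"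
    unfolding padic_cong_def cgenideal_def by auto
  also have "\<dots> \<longleftrightarrow> (a \<ominus>\<^bsub>Zp\<^esub> b) k = 0"
  proof
    assume "\<exists>y\<in>carrier Zp. a \<ominus>\<^bsub>Zp\<^esub> b = y \<otimes>\<^bsub>Zp\<^esub> padic_of_rat p (\<pi> ^ k)"
    then obtain y where "a \<ominus>\<^bsub>Zp\<^esub> b = y \<otimes>\<^bsub>Zp\<^esub> padic_of_rat p (\<pi> ^ k)" by blast
    thus "(a \<ominus>\<^bsub>Zp\<^esub> b) k = 0" by (simp add: padic_int_def padic_of_rat_p_power)
  qed (rule Zp_divisible[OF z])
  finally show ?thesis using eq by simp
qed

lemma Zp_finsum_eval:
  assumes "finite I" "\<And>i. i \<in> I \<Longrightarrow> f i \<in> carrier Zp"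
  shows "(\<Oplus>\<^bsub>Zp\<^esub>i\<in>I. f i) k = (\<Sum>i\<in>I. f i k) mod int p ^ k"
proof -
  interpret R: cring Zp by (rule cring_Zp)
  show ?thesis using assms
  proof (induction I rule: finite_induct)
    case empty
    show ?case by (simp only: R.finsum_empty) (simp add: padic_int_def)
  next
    case (insert i I)
    have "(\<Oplus>\<^bsub>Zp\<^esub>i\<in>insert i I. f i) = f i \<oplus>\<^bsub>Zp\<^esub> (\<Oplus>\<^bsub>Zp\<^esub>i\<in>I. f i)"
      using insert by (intro R.finsum_insert) auto
    hence "(\<Oplus>\<^bsub>Zp\<^esub>i\<in>insert i I. f i) k = (f i k + (\<Oplus>\<^bsub>Zp\<^esub>i\<in>I. f i) k) mod int p ^ k"
      by (simp add: padic_int_def)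
    thus ?case using insert by (simp add: mod_simps)
  qed
qed

lemma padic_of_rat_pcong:
  assumes "pint q" shows "pcong k (of_int (padic_of_rat p q k)) q"
proof (rule pcong_cancel_of_int)
  have "pcong k (of_int (snd (quotient_of q) * padic_of_rat p q k)) (of_int (fst (quotient_of q)))"
    unfolding pcong_of_int by (rule padic_of_rat_cong[OF p assms])
  thus "pcong k (of_int (snd (quotient_of q)) * of_int (padic_of_rat p q k)) (of_int (snd (quotient_of q)) * q)"
    using rat_times_denom[of q] by (simp add: mult.commute)
  show "\<not> int p dvd snd (quotient_of q)" using assms by (simp add: p_integral_def)
qed

text \<open>The bridge to the rational congruences: the residue at any level from \<open>k\<close> on represents the
  element modulo \<open>p ^ k\<close>.\<close>

lemma padic_cong_imp_pcong:
  assumes "x \<in> carrier Zp" "pint q" "padic_cong p k x (padic_of_rat p q)" "k \<le> l"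
  shows "pcong k (of_int (x l)) q"
proof -
  have "x k = padic_of_rat p q k"
    using assms padic_cong_iff padic_of_rat_closed[OF p] by blast
  moreover have "x l mod int p ^ k = x k"
    using Zp_coherent[OF assms(1), of k "l - k"] assms(4) by simp
  ultimately have "pcong k (of_int (x l)) (of_int (padic_of_rat p q k))"
    unfolding pcong_of_int using Zp_bounds[OF assms(1), of k] by (simp add: cong_def)
  thus ?thesis using padic_of_rat_pcong[OF assms(2)] by (rule pcong_trans)
qed

text \<open>The hypothesis uses the residues \<open>x\<^sub>i (l)\<close> at one common level \<open>l\<close> as integers that represent the
  \<open>x\<^sub>i\<close>; any level from \<open>k\<close> on will do.\<close>

lemma padic_cong_sum:
  assumes "finite I" "\<And>i. i \<in> I \<Longrightarrow> x i \<in> carrier Zp"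
    and "pcong k (of_int a) (\<Sum>i\<in>I. of_int (x i l) * \<pi> ^ e i)" "k \<le> l"
  shows "padic_cong p k (padic_of_rat p (of_int a)) (\<Oplus>\<^bsub>Zp\<^esub>i\<in>I. x i \<otimes>\<^bsub>Zp\<^esub> padic_of_rat p (\<pi> ^ e i))"
proof -
  interpret R: cring Zp by (rule cring_Zp)
  have c: "x i \<otimes>\<^bsub>Zp\<^esub> padic_of_rat p (\<pi> ^ e i) \<in> carrier Zp" if "i \<in> I" for i
    using assms(2)[OF that] padic_of_rat_closed[OF p, of "\<pi> ^ e i"] by simp
  have "(\<Oplus>\<^bsub>Zp\<^esub>i\<in>I. x i \<otimes>\<^bsub>Zp\<^esub> padic_of_rat p (\<pi> ^ e i)) k
      = (\<Sum>i\<in>I. (x i \<otimes>\<^bsub>Zp\<^esub> padic_of_rat p (\<pi> ^ e i)) k) mod int p ^ k"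
    using assms(1) c by (rule Zp_finsum_eval)
  also have "(\<Sum>i\<in>I. (x i \<otimes>\<^bsub>Zp\<^esub> padic_of_rat p (\<pi> ^ e i)) k) = (\<Sum>i\<in>I. (x i l * int p ^ e i) mod int p ^ k)"
  proof (rule sum.cong[OF refl])
    fix i assume "i \<in> I"
    have "x i k = x i l mod int p ^ k"
      using Zp_coherent[OF assms(2)[OF \<open>i \<in> I\<close>], of k "l - k"] assms(4) by simp
    thus "(x i \<otimes>\<^bsub>Zp\<^esub> padic_of_rat p (\<pi> ^ e i)) k = (x i l * int p ^ e i) mod int p ^ k"
      by (simp add: padic_int_def padic_of_rat_p_power mod_simps)
  qed
  also have "\<dots> mod int p ^ k = (\<Sum>i\<in>I. x i l * int p ^ e i) mod int p ^ k"
    by (rule mod_sum_eq)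
  also have "\<dots> = a mod int p ^ k"
  proof -
    have "pcong k (of_int a) (of_int (\<Sum>i\<in>I. x i l * int p ^ e i))" using assms(3) by simp
    thus ?thesis unfolding pcong_of_int by (simp add: cong_def)
  qed
  also have "\<dots> = padic_of_rat p (of_int a) k" by (simp add: padic_of_rat_of_int)
  finally show ?thesis
    using padic_of_rat_closed[OF p pint_of_int] c by (subst padic_cong_iff) (auto intro!: R.finsum_closed)
qed

end

section \<open>The expansion of the factorial and of the Wilson quotient\<close>

theorem theorem1p1:
  fixes p :: nat
    and B :: "nat \<Rightarrow> rat"
    and Bd :: "nat \<Rightarrow> nat \<Rightarrow> rat"
  assumes "prime p" and "p \<ge> 7"
    and B: "B = divided_bernoulli p"
    and Bd: "Bd = divided_bernoulli_shift p"
  shows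
    "(\<forall>n\<in>{1..5}. p_integral p (B n)) \<and>
     (\<forall>n\<in>{1..3}. p_integral p (Bd n 2)) \<and>
     p_integral p (Bd 1 4) \<and>
     (\<forall>\<omega> :: nat \<Rightarrow> (nat \<Rightarrow> int).
        (\<forall>\<nu>\<in>{0..5}. \<omega> \<nu> \<in> carrier (padic_int p)) \<and>
        \<omega> 0 = \<ominus>\<^bsub>padic_int p\<^esub> \<one>\<^bsub>padic_int p\<^esub> \<and>
        padic_cong p 5 (\<omega> 1) (padic_of_rat p
          (- 5 * B 1 + 10 * B 2 - 10 * B 3 + 5 * B 4 - B 5)) \<and>
        padic_cong p 4 (\<omega> 2) (padic_of_rat p
          (- (5/2) * (B 1)^2 + 15/2 * (B 2)^2 + 5/2 * (B 3)^2 + B 1 * B 4 - 9 * B 2 * B 3)) \<and>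
        padic_cong p 3 (\<omega> 3) (padic_of_rat p
          (- (1/2) * B 1 * (B 2)^2 - (B 1)^2 * (5/3 * B 1 - 5/2 * B 2 + 1/2 * B 3)
           - Bd 1 2 + Bd 2 2 - 1/3 * Bd 3 2)) \<and>
        padic_cong p 2 (\<omega> 4) (padic_of_rat p
          (- (5/24) * (B 1)^4 + 1/6 * (B 1)^3 * B 2 - 2/3 * B 1 * Bd 1 2 + 1/3 * B 2 * Bd 2 2)) \<and>
        padic_cong p 1 (\<omega> 5) (padic_of_rat p
          (- (1/120) * (B 1)^5 - 1/6 * (B 1)^2 * Bd 1 2 - 1/5 * Bd 1 4))
        \<longrightarrow>
        padic_cong p 5 (padic_of_rat p (wilson_quotient p))
          (\<Oplus>\<^bsub>padic_int p\<^esub>\<nu>\<in>{1..5}. \<omega> \<nu> \<otimes>\<^bsub>padic_int p\<^esub> padic_of_rat p (of_nat p ^ (\<nu> - 1))) \<and>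
        padic_cong p 6 (padic_of_rat p (fact (p - 1)))
          (\<Oplus>\<^bsub>padic_int p\<^esub>\<nu>\<in>{0..5}. \<omega> \<nu> \<otimes>\<^bsub>padic_int p\<^esub> padic_of_rat p (of_nat p ^ \<nu>)))"
proof -
  interpret prime_at_least_7 p
    using assms(1,2) by unfold_locales
  interpret R: cring Zp by (rule cring_Zp)
  note cc = coefficient_congruences[folded B Bd]
  note pc = pint_coefficients[folded Bd]
  show ?thesis
  proof (intro conjI ballI allI impI)
    show "p_integral p (B n)" if "n \<in> {1..5}" for n
      using pint_B[OF that] by (simp add: B)
    show "p_integral p (Bd n 2)" if "n \<in> {1..3}" for n
      using pint_Bd[of n 2] that by (simp add: Bd)
    show "p_integral p (Bd 1 4)"
      using pint_Bd14 by (simp add: Bd)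
  next
    fix \<omega> :: "nat \<Rightarrow> nat \<Rightarrow> int"
    assume h: "(\<forall>\<nu>\<in>{0..5}. \<omega> \<nu> \<in> carrier (padic_int p)) \<and>
        \<omega> 0 = \<ominus>\<^bsub>padic_int p\<^esub> \<one>\<^bsub>padic_int p\<^esub> \<and>
        padic_cong p 5 (\<omega> 1) (padic_of_rat p
          (- 5 * B 1 + 10 * B 2 - 10 * B 3 + 5 * B 4 - B 5)) \<and>
        padic_cong p 4 (\<omega> 2) (padic_of_rat p
          (- (5/2) * (B 1)^2 + 15/2 * (B 2)^2 + 5/2 * (B 3)^2 + B 1 * B 4 - 9 * B 2 * B 3)) \<and>
        padic_cong p 3 (\<omega> 3) (padic_of_rat p
          (- (1/2) * B 1 * (B 2)^2 - (B 1)^2 * (5/3 * B 1 - 5/2 * B 2 + 1/2 * B 3)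
           - Bd 1 2 + Bd 2 2 - 1/3 * Bd 3 2)) \<and>
        padic_cong p 2 (\<omega> 4) (padic_of_rat p
          (- (5/24) * (B 1)^4 + 1/6 * (B 1)^3 * B 2 - 2/3 * B 1 * Bd 1 2 + 1/3 * B 2 * Bd 2 2)) \<and>
        padic_cong p 1 (\<omega> 5) (padic_of_rat p
          (- (1/120) * (B 1)^5 - 1/6 * (B 1)^2 * Bd 1 2 - 1/5 * Bd 1 4))"
    have \<omega>: "\<omega> \<nu> \<in> carrier Zp" if "\<nu> \<in> {0..5}" for \<nu> using h that by blast
    \<comment> \<open>Level 6 is the highest that occurs, so one family of integers represents all coefficients.\<close>
    define w :: "nat \<Rightarrow> rat" where "w = (\<lambda>\<nu>. of_int (\<omega> \<nu> 6))"
    have w0: "pcong 6 (w 0) (- 1)"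
    proof -
      have "\<omega> 0 6 = (- (1 mod int p ^ 6)) mod int p ^ 6"
        using h Zp_minus_eval(2)[OF R.one_closed R.one_closed, of 6] by (simp add: padic_int_def)
      hence "[\<omega> 0 6 = - 1] (mod int p ^ 6)" by (simp add: cong_def mod_simps)
      hence "pcong 6 (of_int (\<omega> 0 6)) (of_int (- 1))" unfolding pcong_of_int .
      thus ?thesis by (simp add: w_def)
    qed
    have w1: "pcong 5 (w 1) (- \<beta>)"
      unfolding w_def cc(1)[symmetric]
      by (rule padic_cong_imp_pcong[OF \<omega>]) (use h pint_beta cc(1) in auto)
    have w2: "pcong 4 (w 2) (- (\<beta>\<^sup>2 / 2))"
      unfolding w_def by (rule pcong_trans[OF padic_cong_imp_pcong[OF \<omega> pcong_pint[OF cc(2) pc(1)]] cc(2)])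
        (use h in auto)
    have w3: "pcong 3 (w 3) (- (\<beta> ^ 3 / 6 + \<delta> / 3))"
      unfolding w_def by (rule pcong_trans[OF padic_cong_imp_pcong[OF \<omega> pcong_pint[OF cc(3) pc(2)]] cc(3)])
        (use h in auto)
    have w4: "pcong 2 (w 4) (- (\<beta> ^ 4 / 24 + \<beta> * \<delta> / 3))"
      unfolding w_def by (rule pcong_trans[OF padic_cong_imp_pcong[OF \<omega> pcong_pint[OF cc(4) pc(3)]] cc(4)])
        (use h in auto)
    have w5: "pcong 1 (w 5) (- (\<beta> ^ 5 / 120 + \<beta>\<^sup>2 * \<delta> / 6 + Bd 1 4 / 5))"
      unfolding w_def by (rule pcong_trans[OF padic_cong_imp_pcong[OF \<omega> pcong_pint[OF cc(5) pc(4)]] cc(5)])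
        (use h in auto)
    have "pcong 6 (- fact (p - 1)) (1 + \<pi> * \<beta> + \<pi>\<^sup>2 * (\<beta>\<^sup>2 / 2) + \<pi> ^ 3 * (\<beta> ^ 3 / 6 + \<delta> / 3)
        + \<pi> ^ 4 * (\<beta> ^ 4 / 24 + \<beta> * \<delta> / 3) + \<pi> ^ 5 * (\<beta> ^ 5 / 120 + \<beta>\<^sup>2 * \<delta> / 6 + Bd 1 4 / 5))"
      using neg_fact_expansion by (simp add: Bd)
    from pcong_minus[OF this]
    have "pcong 6 (fact (p - 1)) (- 1 + \<pi> ^ 1 * (- \<beta>) + \<pi>\<^sup>2 * (- (\<beta>\<^sup>2 / 2)) + \<pi> ^ 3 * (- (\<beta> ^ 3 / 6 + \<delta> / 3))
        + \<pi> ^ 4 * (- (\<beta> ^ 4 / 24 + \<beta> * \<delta> / 3)) + \<pi> ^ 5 * (- (\<beta> ^ 5 / 120 + \<beta>\<^sup>2 * \<delta> / 6 + Bd 1 4 / 5)))"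
      by (simp add: algebra_simps)
    also have "pcong 6 \<dots> (w 0 + \<pi> ^ 1 * w 1 + \<pi>\<^sup>2 * w 2 + \<pi> ^ 3 * w 3 + \<pi> ^ 4 * w 4 + \<pi> ^ 5 * w 5)"
    proof (rule pcong_sym, intro pcong_add w0)
      show "pcong 6 (\<pi> ^ 1 * w 1) (\<pi> ^ 1 * (- \<beta>))"
        using pcong_scale[THEN iffD1, OF w1, of 1] by simp
      show "pcong 6 (\<pi>\<^sup>2 * w 2) (\<pi>\<^sup>2 * (- (\<beta>\<^sup>2 / 2)))"
        using pcong_scale[THEN iffD1, OF w2, of 2] by simp
      show "pcong 6 (\<pi> ^ 3 * w 3) (\<pi> ^ 3 * (- (\<beta> ^ 3 / 6 + \<delta> / 3)))"
        using pcong_scale[THEN iffD1, OF w3, of 3] by simp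
      show "pcong 6 (\<pi> ^ 4 * w 4) (\<pi> ^ 4 * (- (\<beta> ^ 4 / 24 + \<beta> * \<delta> / 3)))"
        using pcong_scale[THEN iffD1, OF w4, of 4] by simp
      show "pcong 6 (\<pi> ^ 5 * w 5) (\<pi> ^ 5 * (- (\<beta> ^ 5 / 120 + \<beta>\<^sup>2 * \<delta> / 6 + Bd 1 4 / 5)))"
        using pcong_scale[THEN iffD1, OF w5, of 5] by simp
    qed
    finally have main: "pcong 6 (fact (p - 1)) (w 0 + \<pi> * w 1 + \<pi>\<^sup>2 * w 2 + \<pi> ^ 3 * w 3 + \<pi> ^ 4 * w 4 + \<pi> ^ 5 * w 5)"
      by simp
    have s05: "{0..5} = {0, 1, 2, 3, 4, 5::nat}" and s15: "{1..5} = {1, 2, 3, 4, 5::nat}" by auto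
    have "pcong 6 (of_int (fact (p - 1))) (\<Sum>\<nu>\<in>{0..5}. of_int (\<omega> \<nu> 6) * \<pi> ^ \<nu>)"
      using main unfolding s05 w_def by (simp add: mult.commute add.assoc)
    from padic_cong_sum[OF _ \<omega> this]
    show "padic_cong p 6 (padic_of_rat p (fact (p - 1)))
          (\<Oplus>\<^bsub>Zp\<^esub>\<nu>\<in>{0..5}. \<omega> \<nu> \<otimes>\<^bsub>Zp\<^esub> padic_of_rat p (of_nat p ^ \<nu>))"
      by simp
    \<comment> \<open>Dividing the congruence for \<open>(p-1)! + 1\<close> by \<open>p\<close> gives the one for the Wilson quotient.\<close>
    obtain W where W: "fact (p - 1) - (- 1) = int p * W"
      using wilson_theorem[OF p] by (auto simp only: cong_iff_dvd_diff dvd_def)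
    hence "of_int (fact (p - 1) - (- 1)) = (of_int (int p * W) :: rat)" by (simp only: W)
    hence Wr: "fact (p - 1) + 1 = \<pi> * of_int W" by simp
    have "pcong 6 (fact (p - 1) - (- 1)) (w 0 + \<pi> * w 1 + \<pi>\<^sup>2 * w 2 + \<pi> ^ 3 * w 3 + \<pi> ^ 4 * w 4 + \<pi> ^ 5 * w 5 - w 0)"
      by (rule pcong_diff[OF main pcong_sym[OF w0]])
    hence "pcong (1 + 5) (\<pi> ^ 1 * of_int W) (\<pi> ^ 1 * (w 1 + \<pi> * w 2 + \<pi>\<^sup>2 * w 3 + \<pi> ^ 3 * w 4 + \<pi> ^ 4 * w 5))"
      using Wr by (simp add: algebra_simps eval_nat_numeral)
    hence "pcong 5 (of_int W) (w 1 + \<pi> * w 2 + \<pi>\<^sup>2 * w 3 + \<pi> ^ 3 * w 4 + \<pi> ^ 4 * w 5)"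
      unfolding pcong_scale[symmetric] .
    hence "pcong 5 (of_int W) (\<Sum>\<nu>\<in>{1..5}. of_int (\<omega> \<nu> 6) * \<pi> ^ (\<nu> - 1))"
      unfolding s15 w_def by (simp add: mult.commute add.assoc)
    from padic_cong_sum[OF _ \<omega> this]
    have "padic_cong p 5 (padic_of_rat p (of_int W))
          (\<Oplus>\<^bsub>Zp\<^esub>\<nu>\<in>{1..5}. \<omega> \<nu> \<otimes>\<^bsub>Zp\<^esub> padic_of_rat p (of_nat p ^ (\<nu> - 1)))"
      by simp
    moreover have "wilson_quotient p = of_int W"
      unfolding wilson_quotient_def Wr by simp
    ultimately show "padic_cong p 5 (padic_of_rat p (wilson_quotient p))
          (\<Oplus>\<^bsub>Zp\<^esub>\<nu>\<in>{1..5}. \<omega> \<nu> \<otimes>\<^bsub>Zp\<^esub> padic_of_rat p (of_nat p ^ (\<nu> - 1)))"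
      by simp
  qed
qed

end
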